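(* Let $\mathcal{G}$ be a minor-closed class of graphs. Then $\mathcal{G}$ has bounded layered pathwidth (i.e. there is a constant $c$ with $\operatorname{lpw}(G)\le c$ for all $G\in\mathcal{G}$) if and only if some apex-forest is not in $\mathcal{G}$.
   Context: All graphs are finite and simple. A class $\mathcal{G}$ is minor-closed if every minor of every graph in $\mathcal{G}$ is in $\mathcal{G}$. A path decomposition of $G$ is a sequence $(B_1,\dots,B_n)$ of subsets of $V(G)$ (bags) such that every edge has both endpoints in some bag and, for each vertex $v$, the set $\{i: v\in B_i\}$ is a non-empty interval. A layering of $G$ is a partition $(V_0,\dots,V_t)$ of $V(G)$ such that for every edge $vw$ with $v\in V_i$, $w\in V_j$ we have $|i-j|\le 1$. The layered width of a path decomposition is the minimum $\ell$ such that for some layering, each bag contains at most $\ell$ vertices of each layer. The layered pathwidth $\operatorname{lpw}(G)$ is the minimum layered width of a path decomposition of $G$. A graph $G$ is an apex-forest if $G-v$ is a forest for some vertex $v$. *)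

theory Defs
  imports Main
begin

text \<open>Finite simple graphs with vertices drawn from nat: a pair (V, E) where
  V is a finite vertex set and E is a set of 2-element subsets of V.
  Using nat as vertex type, every finite graph is represented up to isomorphism.\<close>

type_synonym graph = "nat set \<times> nat set set"

definition verts :: "graph \<Rightarrow> nat set" where "verts G = fst G"
definition edges :: "graph \<Rightarrow> nat set set" where "edges G = snd G"

definition simple_graph :: "graph \<Rightarrow> bool" where
  "simple_graph G \<longleftrightarrow> finite (verts G) \<and>
     (\<forall>e\<in>edges G. \<exists>u v. e = {u, v} \<and> u \<noteq> v \<and> u \<in> verts G \<and> v \<in> verts G)"

text \<open>B induces a connected subgraph of G (B nonempty).\<close>
definition connected_in :: "graph \<Rightarrow> nat set \<Rightarrow> bool" where
  "connected_in G B \<longleftrightarrow> B \<noteq> {} \<and> B \<subseteq> verts G \<and>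
     (\<forall>x\<in>B. \<forall>y\<in>B. (x, y) \<in> {(a, b). a \<in> B \<and> b \<in> B \<and> {a, b} \<in> edges G}\<^sup>*)"

text \<open>H is a minor of G: there is a model of H in G, i.e. pairwise disjoint
  connected branch sets, with an edge of G between the branch sets of adjacent vertices
  of H. (Standard equivalent of "isomorphic to a graph obtained by deletions and
  contractions".)\<close>
definition minor :: "graph \<Rightarrow> graph \<Rightarrow> bool" where
  "minor H G \<longleftrightarrow> (\<exists>br :: nat \<Rightarrow> nat set.
     (\<forall>v\<in>verts H. connected_in G (br v)) \<and>
     (\<forall>v\<in>verts H. \<forall>w\<in>verts H. v \<noteq> w \<longrightarrow> br v \<inter> br w = {}) \<and>
     (\<forall>v w. {v, w} \<in> edges H \<longrightarrow> (\<exists>x\<in>br v. \<exists>y\<in>br w. {x, y} \<in> edges G)))"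

definition minor_closed :: "graph set \<Rightarrow> bool" where
  "minor_closed \<G> \<longleftrightarrow> (\<forall>G\<in>\<G>. \<forall>H. simple_graph H \<and> minor H G \<longrightarrow> H \<in> \<G>)"

text \<open>Cycles and forests.\<close>
definition is_cycle :: "graph \<Rightarrow> nat list \<Rightarrow> bool" where
  "is_cycle G xs \<longleftrightarrow> length xs \<ge> 3 \<and> distinct xs \<and> set xs \<subseteq> verts G \<and>
     (\<forall>i. Suc i < length xs \<longrightarrow> {xs ! i, xs ! Suc i} \<in> edges G) \<and>
     {last xs, hd xs} \<in> edges G"

definition forest :: "graph \<Rightarrow> bool" where
  "forest G \<longleftrightarrow> \<not> (\<exists>xs. is_cycle G xs)"

definition delete_vertex :: "graph \<Rightarrow> nat \<Rightarrow> graph" where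
  "delete_vertex G v = (verts G - {v}, {e \<in> edges G. v \<notin> e})"

definition apex_forest :: "graph \<Rightarrow> bool" where
  "apex_forest G \<longleftrightarrow> (\<exists>v\<in>verts G. forest (delete_vertex G v))"

text \<open>Path decompositions: a list of bags (B_1,...,B_n).\<close>
definition path_decomposition :: "graph \<Rightarrow> nat set list \<Rightarrow> bool" where
  "path_decomposition G P \<longleftrightarrow>
     (\<forall>B\<in>set P. B \<subseteq> verts G) \<and>
     (\<forall>e\<in>edges G. \<exists>B\<in>set P. e \<subseteq> B) \<and>
     (\<forall>v\<in>verts G. (\<exists>i<length P. v \<in> P ! i) \<and>
        (\<forall>i j k. i \<le> j \<and> j \<le> k \<and> k < length P \<and> v \<in> P ! i \<and> v \<in> P ! k \<longrightarrow> v \<in> P ! j))"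

text \<open>A layering: vertex v lies in layer V_(L v); edges join equal or consecutive layers.\<close>
definition layering :: "graph \<Rightarrow> (nat \<Rightarrow> nat) \<Rightarrow> bool" where
  "layering G L \<longleftrightarrow> (\<forall>v w. {v, w} \<in> edges G \<longrightarrow> L v \<le> L w + 1 \<and> L w \<le> L v + 1)"

definition layered_width_le :: "nat set list \<Rightarrow> (nat \<Rightarrow> nat) \<Rightarrow> nat \<Rightarrow> bool" where
  "layered_width_le P L l \<longleftrightarrow> (\<forall>B\<in>set P. \<forall>i. card {v \<in> B. L v = i} \<le> l)"

definition lpw :: "graph \<Rightarrow> nat" where
  "lpw G = (LEAST l. \<exists>P L. path_decomposition G P \<and> layering G L \<and> layered_width_le P L l)"

end

theory Submission
  imports Defs
begin

text \<open>Let an apex-forest \<open>H\<close> be excluded, and let \<open>F\<close> be \<open>H\<close> without its apex. The key is a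
  rooted version of Diestel's proof of the path-width theorem: if a graph has no \<open>F\<close>-model all
  of whose branch sets meet \<open>R\<close>, then it has a chain of vertex sets with small boundaries such that
  few vertices of \<open>R\<close> are added in each step. The boundaries together with \<open>R\<close> form a set \<open>S\<close>
  with a path decomposition of bounded width such that each component of the rest attaches to a
  single bag. Take a connected hub \<open>Q\<close>, and let \<open>R\<close> be the set of its neighbours: an \<open>F\<close>-model
  rooted in \<open>R\<close> is impossible, since \<open>Q\<close> would be the branch set of the apex. Make \<open>S\<close> the next
  layer. If \<open>S\<close> is chosen of minimum size, then the complement of each remaining component is
  again connected, hence it is the hub for that component, and the construction can be iterated.
  Note that the layers are in general not those of a breadth-first search.

  Conversely, a dominating vertex forces a layering to use at most three layers, so bounded layered
  pathwidth of all apex-forests would bound the pathwidth of complete ternary trees.\<close>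

text \<open>The pathwidth of \<open>G\<close> itself cannot be bounded: forests have no triangle
  minor, and the triangle is an apex-forest, yet the pathwidth of forests is unbounded. So only the
  vertices next to the hub are decomposed with bounded width, and the rest is deferred to later
  layers. A final bag collects one spine bag from each depth of the recursion; the depth is the
  layer number, so these bags do not add up within a layer. The next hub consists of everything
  outside \<open>D\<close>, so that every vertex of \<open>D\<close> with a neighbour outside
  \<open>D\<close> falls into the next layer. It must be connected to serve as the branch set of the
  apex, which could fail only if a part of \<open>C\<close> reached the old hub solely through
  \<open>D\<close>; minimality of the spine rules this out. In the bound \<open>3 * card W\<close>,
  a bag consists of two consecutive boundaries and the vertices of \<open>R\<close> added between
  them, at most \<open>card W\<close> each. The final \<open>+ 1\<close> pays for the single vertex
  that is the first hub.\<close>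

subsection \<open>Connected sets and linkages\<close>

text \<open>Connectedness of an induced subgraph, phrased by cuts: every nontrivial part
  has an edge leaving it.\<close>

definition conn :: "('a \<Rightarrow> 'a \<Rightarrow> bool) \<Rightarrow> 'a set \<Rightarrow> bool" where
  "conn adj A \<longleftrightarrow> A \<noteq> {} \<and> (\<forall>S. S \<subseteq> A \<and> S \<noteq> {} \<and> S \<noteq> A \<longrightarrow> (\<exists>x\<in>S. \<exists>y\<in>A - S. adj x y))"

lemma connI:
  assumes "A \<noteq> {}" "\<And>S. S \<subseteq> A \<Longrightarrow> S \<noteq> {} \<Longrightarrow> S \<noteq> A \<Longrightarrow> \<exists>x\<in>S. \<exists>y\<in>A - S. adj x y"
  shows "conn adj A"
  unfolding conn_def using assms by simp

lemma conn_nonempty: "conn adj A \<Longrightarrow> A \<noteq> {}"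
  by (simp add: conn_def)

lemma connD:
  assumes "conn adj A" "S \<subseteq> A" "S \<noteq> {}" "S \<noteq> A"
  obtains x y where "x \<in> S" "y \<in> A" "y \<notin> S" "adj x y"
proof -
  have "\<exists>x\<in>S. \<exists>y\<in>A - S. adj x y" using assms unfolding conn_def by simp
  then show ?thesis using that by blast
qed

lemma conn_singleton: "conn adj {x}"
  by (rule connI) auto

lemma conn_mono: "conn adj A \<Longrightarrow> (\<And>x y. adj x y \<Longrightarrow> adj' x y) \<Longrightarrow> conn adj' A"
  by (rule connI) (simp_all add: conn_def, meson)

lemma conn_Un_edge:
  assumes "symp adj" "conn adj A" "conn adj B" "x \<in> A" "y \<in> B" "adj x y"
  shows "conn adj (A \<union> B)"
proof -
  have "\<exists>x\<in>S. \<exists>y\<in>A \<union> B - S. adj x y" if S: "S \<subseteq> A \<union> B" "S \<noteq> {}" "S \<noteq> A \<union> B" for S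
  proof (cases "(S \<inter> A = {} \<or> S \<inter> A = A) \<and> (S \<inter> B = {} \<or> S \<inter> B = B)")
    case True
    have "adj y x" using assms(1,6) by (meson sympD)
    from True consider "S \<inter> A = A" "S \<inter> B = {}" | "S \<inter> A = {}" "S \<inter> B = B"
      using S by blast
    then show ?thesis
    proof cases
      case 1
      then have "x \<in> S" "y \<in> A \<union> B - S" using assms(4,5) by auto
      then show ?thesis using assms(6) by blast
    next
      case 2
      then have "y \<in> S" "x \<in> A \<union> B - S" using assms(4,5) by auto
      then show ?thesis using \<open>adj y x\<close> by blast
    qed
  next
    case False
    then consider "S \<inter> A \<noteq> {}" "S \<inter> A \<noteq> A" | "S \<inter> B \<noteq> {}" "S \<inter> B \<noteq> B" by blast
    then show ?thesis
    proof cases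
      case 1
      then obtain x y where "x \<in> S \<inter> A" "y \<in> A" "y \<notin> S \<inter> A" "adj x y"
        using connD[OF assms(2), of "S \<inter> A"] by blast
      then show ?thesis by blast
    next
      case 2
      then obtain x y where "x \<in> S \<inter> B" "y \<in> B" "y \<notin> S \<inter> B" "adj x y"
        using connD[OF assms(3), of "S \<inter> B"] by blast
      then show ?thesis by blast
    qed
  qed
  moreover have "A \<union> B \<noteq> {}" using assms(4) by blast
  ultimately show ?thesis by (intro connI)
qed

lemma conn_Union:
  assumes "\<And>A. A \<in> \<A> \<Longrightarrow> conn adj A" "\<And>A. A \<in> \<A> \<Longrightarrow> z \<in> A" "\<A> \<noteq> {}"
  shows "conn adj (\<Union>\<A>)"
proof -
  have "\<exists>x\<in>S. \<exists>y\<in>\<Union>\<A> - S. adj x y" if S: "S \<subseteq> \<Union>\<A>" "S \<noteq> {}" "S \<noteq> \<Union>\<A>" for S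
  proof -
    have "\<exists>A\<in>\<A>. S \<inter> A \<noteq> {} \<and> S \<inter> A \<noteq> A"
    proof (cases "z \<in> S")
      case True
      obtain y A where "y \<notin> S" "A \<in> \<A>" "y \<in> A" using S(1,3) by blast
      then show ?thesis using True assms(2)[of A] by (intro bexI[of _ A]) auto
    next
      case False
      obtain y A where "y \<in> S" "A \<in> \<A>" "y \<in> A" using S(1,2) by blast
      then show ?thesis using False assms(2)[of A] by (intro bexI[of _ A]) auto
    qed
    then obtain A where A: "A \<in> \<A>" "S \<inter> A \<noteq> {}" "S \<inter> A \<noteq> A" by blast
    then obtain x y where "x \<in> S \<inter> A" "y \<in> A" "y \<notin> S \<inter> A" "adj x y"
      using connD[OF assms(1)[OF A(1)], of "S \<inter> A"] by blast
    then show ?thesis using A(1) by blast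
  qed
  moreover have "\<Union>\<A> \<noteq> {}" using assms(2,3) by blast
  ultimately show ?thesis by (intro connI)
qed

lemma conn_Un:
  assumes "conn adj A" "conn adj B" "z \<in> A" "z \<in> B"
  shows "conn adj (A \<union> B)"
proof -
  have "conn adj (\<Union>{A, B})"
    using assms by (intro conn_Union[of "{A, B}" adj z]) auto
  then show ?thesis by simp
qed

lemma conn_separated:
  assumes "conn adj D" "D \<subseteq> A \<union> B" "D \<inter> A \<noteq> {}" "\<And>x y. x \<in> A \<Longrightarrow> y \<in> B - A \<Longrightarrow> \<not> adj x y"
  shows "D \<subseteq> A"
proof (rule ccontr)
  assume "\<not> D \<subseteq> A"
  then obtain x y where "x \<in> D \<inter> A" "y \<in> D" "y \<notin> D \<inter> A" "adj x y"
    using connD[OF assms(1), of "D \<inter> A"] assms(3) by blast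
  then show False using assms(2,4) by blast
qed

section \<open>Components of an induced subgraph\<close>

definition component :: "('a \<Rightarrow> 'a \<Rightarrow> bool) \<Rightarrow> 'a set \<Rightarrow> 'a set \<Rightarrow> bool" where
  "component adj A D \<longleftrightarrow> conn adj D \<and> D \<subseteq> A \<and> (\<forall>x\<in>D. \<forall>y\<in>A - D. \<not> adj x y)"

text \<open>All connected sets between \<open>Q\<close> and \<open>A\<close> share the points of
  \<open>Q\<close>, so their union is connected; a neighbour in \<open>A\<close> outside the union
  could still be added.\<close>

lemma component_exists:
  assumes "symp adj" "conn adj Q" "Q \<subseteq> A"
  obtains D where "component adj A D" "Q \<subseteq> D"
proof -
  let ?\<D> = "{D. conn adj D \<and> Q \<subseteq> D \<and> D \<subseteq> A}"
  obtain z where "z \<in> Q" using assms(2) unfolding conn_def by blast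
  then have c: "conn adj (\<Union>?\<D>)"
    using assms by (intro conn_Union[of _ _ z]) auto
  have "Q \<in> ?\<D>" using assms by blast
  have "\<not> adj x y" if "x \<in> \<Union>?\<D>" "y \<in> A - \<Union>?\<D>" for x y
  proof
    assume "adj x y"
    then have "conn adj (\<Union>?\<D> \<union> {y})"
      using conn_Un_edge[OF assms(1) c conn_singleton, of x y y] that(1) by blast
    then have "\<Union>?\<D> \<union> {y} \<in> ?\<D>" using that(2) \<open>Q \<in> ?\<D>\<close> by blast
    then show False using that(2) by blast
  qed
  then have "component adj A (\<Union>?\<D>)" using c unfolding component_def by blast
  then show ?thesis using that[of "\<Union>?\<D>"] \<open>Q \<in> ?\<D>\<close> by blast
qed

lemma component_disjoint:
  assumes "component adj A D" "component adj A D'" "D \<noteq> D'"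
  shows "D \<inter> D' = {}"
proof (rule ccontr)
  assume n: "D \<inter> D' \<noteq> {}"
  have "D \<subseteq> D'" if "component adj A D" "component adj A D'" "D \<inter> D' \<noteq> {}" for D D'
    using that conn_separated[of adj D D' A] unfolding component_def by blast
  then show False using n assms by blast
qed

text \<open>The vertices of \<open>D\<close> always count as boundary, as if each had a neighbour
  outside \<open>Y\<close>; this lets one linkage lemma serve for arbitrary targets \<open>D\<close>.\<close>

definition bd :: "('a \<Rightarrow> 'a \<Rightarrow> bool) \<Rightarrow> 'a set \<Rightarrow> 'a set \<Rightarrow> 'a set \<Rightarrow> 'a set" where
  "bd adj Y D Z = {z \<in> Z. z \<in> D \<or> (\<exists>y\<in>Y - Z. adj z y)}"

lemma bd_subset: "bd adj Y D Z \<subseteq> Z"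
  unfolding bd_def by blast

text \<open>Connected sets instead of paths: they are later absorbed into branch sets, so their
  shape does not matter.\<close>

definition linked :: "('a \<Rightarrow> 'a \<Rightarrow> bool) \<Rightarrow> 'a set \<Rightarrow> 'a set \<Rightarrow> 'a set \<Rightarrow> bool" where
  "linked adj Y D X \<longleftrightarrow> (\<exists>P.
    (\<forall>x\<in>bd adj Y D X. P x \<inter> X = {x} \<and> conn adj (P x) \<and> P x \<subseteq> Y \<and> P x \<inter> D \<noteq> {}) \<and>
    (\<forall>x\<in>bd adj Y D X. \<forall>x'\<in>bd adj Y D X. x \<noteq> x' \<longrightarrow> P x \<inter> P x' = {}))"

lemma linkedI:
  assumes "\<And>x. x \<in> bd adj Y D X \<Longrightarrow> P x \<inter> X = {x} \<and> conn adj (P x) \<and> P x \<subseteq> Y \<and> P x \<inter> D \<noteq> {}"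
    "\<And>x x'. x \<in> bd adj Y D X \<Longrightarrow> x' \<in> bd adj Y D X \<Longrightarrow> x \<noteq> x' \<Longrightarrow> P x \<inter> P x' = {}"
  shows "linked adj Y D X"
  unfolding linked_def
proof (intro exI[of _ P] conjI ballI impI)
qed (use assms in simp_all)

lemma linkedE:
  assumes "linked adj Y D X"
  obtains P where "\<And>x. x \<in> bd adj Y D X \<Longrightarrow> P x \<inter> X = {x} \<and> conn adj (P x) \<and> P x \<subseteq> Y \<and> P x \<inter> D \<noteq> {}"
    "\<And>x x'. x \<in> bd adj Y D X \<Longrightarrow> x' \<in> bd adj Y D X \<Longrightarrow> x \<noteq> x' \<Longrightarrow> P x \<inter> P x' = {}"
proof -
  from assms obtain P where
    "\<forall>x\<in>bd adj Y D X. P x \<inter> X = {x} \<and> conn adj (P x) \<and> P x \<subseteq> Y \<and> P x \<inter> D \<noteq> {}"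
    "\<forall>x\<in>bd adj Y D X. \<forall>x'\<in>bd adj Y D X. x \<noteq> x' \<longrightarrow> P x \<inter> P x' = {}"
    unfolding linked_def by (elim exE conjE)
  then show ?thesis by (intro that[of P]) simp_all
qed

text \<open>Menger's theorem in terms of boundaries. Either some set strictly between \<open>X\<close> and
  \<open>Y\<close> has an equally small boundary and two linkages can be concatenated, or some edge leaving
  \<open>X\<close> can be deleted without violating the hypothesis.\<close>

lemma linkage:
  fixes adj :: "'a \<Rightarrow> 'a \<Rightarrow> bool"
  assumes "finite Y" "symp adj" "D \<subseteq> Y" "X \<subseteq> Y"
    and "\<And>Z. X \<subseteq> Z \<Longrightarrow> Z \<subseteq> Y \<Longrightarrow> card (bd adj Y D X) \<le> card (bd adj Y D Z)"
  shows "linked adj Y D X"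
  using assms
\<comment> \<open>Concatenation replaces \<open>Y - X\<close> by a smaller difference for both
  pieces; deleting an edge keeps \<open>Y - X\<close> and lowers the second summand.\<close>
proof (induction "card (Y - X) + card {(a, b). a \<in> Y \<and> b \<in> Y \<and> adj a b}"
    arbitrary: Y X D adj rule: less_induct)
  case less
  let ?b = "bd adj Y D"
  note fY = less.prems(1) and sy = less.prems(2)
  have fb: "finite (?b Z)" if "Z \<subseteq> Y" for Z
    using that fY bd_subset[of adj Y D Z] by (meson finite_subset)
  show ?case
  proof (cases "\<exists>Z. X \<subset> Z \<and> Z \<subset> Y \<and> card (?b Z) = card (?b X)")
    case True
    then obtain Z where Z: "X \<subset> Z" "Z \<subset> Y" "card (?b Z) = card (?b X)" by blast
    \<comment> \<open>With target \<open>?b Z\<close>, restriction from \<open>Y\<close> to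
      \<open>Z\<close> changes no boundary: a vertex of \<open>Z\<close> that loses neighbours in
      \<open>Y - Z\<close> lies in the target.\<close>
    have eq: "bd adj Z (?b Z) W = ?b W" if "X \<subseteq> W" "W \<subseteq> Z" for W
      using that Z(2) unfolding bd_def by blast
    have fin: "finite {(a, b). a \<in> Y \<and> b \<in> Y \<and> adj a b}"
      by (rule finite_subset[of _ "Y \<times> Y"]) (use fY in auto)
    have "card (Z - X) + card {(a, b). a \<in> Z \<and> b \<in> Z \<and> adj a b}
        < card (Y - X) + card {(a, b). a \<in> Y \<and> b \<in> Y \<and> adj a b}"
    proof (rule add_less_le_mono)
      show "card (Z - X) < card (Y - X)"
        using Z(1,2) fY by (intro psubset_card_mono) auto
      show "card {(a, b). a \<in> Z \<and> b \<in> Z \<and> adj a b} \<le> card {(a, b). a \<in> Y \<and> b \<in> Y \<and> adj a b}"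
        using Z fin by (intro card_mono) auto
    qed
    moreover have "finite Z" "?b Z \<subseteq> Z" "X \<subseteq> Z"
      using Z fY bd_subset[of adj Y D Z] by (auto intro: finite_subset)
    moreover have "card (bd adj Z (?b Z) X) \<le> card (bd adj Z (?b Z) W)" if "X \<subseteq> W" "W \<subseteq> Z" for W
    proof -
      have "card (?b X) \<le> card (?b W)" using less.prems(5)[of W] that Z by blast
      then show ?thesis using eq[OF that] eq[of X] Z(1) by simp
    qed
    ultimately have l: "linked adj Z (?b Z) X" by (intro less.hyps[OF _ _ sy])
    have e: "bd adj Z (?b Z) X = ?b X" using eq[of X] Z(1) by blast
    obtain P where P: "\<And>x. x \<in> ?b X \<Longrightarrow> P x \<inter> X = {x} \<and> conn adj (P x) \<and> P x \<subseteq> Z \<and> P x \<inter> ?b Z \<noteq> {}"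
      "\<And>x x'. x \<in> ?b X \<Longrightarrow> x' \<in> ?b X \<Longrightarrow> x \<noteq> x' \<Longrightarrow> P x \<inter> P x' = {}"
      using linkedE[OF l, unfolded e] by blast
    have lt: "card (Y - Z) + card {(a, b). a \<in> Y \<and> b \<in> Y \<and> adj a b}
        < card (Y - X) + card {(a, b). a \<in> Y \<and> b \<in> Y \<and> adj a b}"
      using Z(1,2) fY by (intro add_less_le_mono psubset_card_mono) auto
    have "card (?b Z) \<le> card (?b W)" if "Z \<subseteq> W" "W \<subseteq> Y" for W
      using less.prems(5)[of W] that Z by (metis order_trans psubset_imp_subset)
    then have l': "linked adj Y D Z"
      by (rule less.hyps[OF lt fY sy less.prems(3) psubset_imp_subset[OF Z(2)]])
    obtain P' where P': "\<And>x. x \<in> ?b Z \<Longrightarrow> P' x \<inter> Z = {x} \<and> conn adj (P' x) \<and> P' x \<subseteq> Y \<and> P' x \<inter> D \<noteq> {}"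
      "\<And>x x'. x \<in> ?b Z \<Longrightarrow> x' \<in> ?b Z \<Longrightarrow> x \<noteq> x' \<Longrightarrow> P' x \<inter> P' x' = {}"
      using linkedE[OF l'] by blast
    from P(1) have "\<forall>x\<in>?b X. \<exists>z. z \<in> P x \<inter> ?b Z" by blast
    then obtain z where z: "\<And>x. x \<in> ?b X \<Longrightarrow> z x \<in> P x" "\<And>x. x \<in> ?b X \<Longrightarrow> z x \<in> ?b Z"
      by (metis IntD1 IntD2)
    \<comment> \<open>The first linkage lies in \<open>Z\<close>, and each set of the second meets
      \<open>Z\<close> only in its start. So if \<open>P x\<close> met \<open>P' (z x')\<close>, it
      would contain \<open>z x'\<close>, which lies in the disjoint set \<open>P x'\<close>.\<close>
    let ?R = "\<lambda>x. P x \<union> P' (z x)"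
    have "?R x \<inter> X = {x} \<and> conn adj (?R x) \<and> ?R x \<subseteq> Y \<and> ?R x \<inter> D \<noteq> {}" if x: "x \<in> ?b X" for x
    proof -
      have a: "P x \<inter> X = {x}" "conn adj (P x)" "P x \<subseteq> Z" using P(1)[OF x] by auto
      have b: "P' (z x) \<inter> Z = {z x}" "conn adj (P' (z x))" "P' (z x) \<subseteq> Y" "P' (z x) \<inter> D \<noteq> {}"
        using P'(1)[OF z(2)[OF x]] by auto
      note c = z(1)[OF x]
      have "z x \<in> P' (z x)" using b(1) by blast
      then have "conn adj (?R x)" using conn_Un[OF a(2) b(2) c] by blast
      moreover have "P' (z x) \<inter> X \<subseteq> {z x} \<inter> X" using b(1) Z(1) by blast
      moreover have "{z x} \<inter> X \<subseteq> {x}" using a(1) c by blast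
      ultimately have "?R x \<inter> X = {x}" "conn adj (?R x)" using a(1) by auto
      moreover have "?R x \<subseteq> Y" using a(3) b(3) Z(2) by blast
      moreover have "?R x \<inter> D \<noteq> {}" using b(4) by blast
      ultimately show ?thesis by blast
    qed
    moreover have "?R x \<inter> ?R x' = {}" if x: "x \<in> ?b X" "x' \<in> ?b X" "x \<noteq> x'" for x x'
    proof -
      have sep: "P x \<inter> P' (z x') = {}" if x: "x \<in> ?b X" "x' \<in> ?b X" "x \<noteq> x'" for x x'
      proof -
        have "P x \<subseteq> Z" using P(1)[OF x(1)] by blast
        then have "P x \<inter> P' (z x') \<subseteq> P x \<inter> {z x'}" using P'(1)[OF z(2)[OF x(2)]] by blast
        then show ?thesis using P(2)[OF x] z(1)[OF x(2)] by blast
      qed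
      have zz: "z x \<noteq> z x'" using P(2)[OF x] z(1)[OF x(1)] z(1)[OF x(2)] by force
      show ?thesis
        using sep[OF x] sep[OF x(2,1)] x(3) P(2)[OF x] P'(2)[OF z(2)[OF x(1)] z(2)[OF x(2)] zz]
        by (simp add: Int_Un_distrib Int_Un_distrib2 Int_commute)
    qed
    ultimately show ?thesis by (intro linkedI[of _ _ _ _ ?R])
  next
    case no: False
    show ?thesis
    proof (cases "?b X \<subseteq> D")
      case True
      have "x \<in> X \<and> x \<in> D" if "x \<in> ?b X" for x
        using that True bd_subset[of adj Y D X] by blast
      then show ?thesis
        using less.prems(4) by (intro linkedI[of _ _ _ _ "\<lambda>x. {x}"]) (use conn_singleton[of adj] in blast)+
    next
      case False
      then obtain x where x: "x \<in> ?b X" "x \<notin> D" by blast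
      then obtain y where y: "y \<in> Y - X" "adj x y" unfolding bd_def by blast
      have xX: "x \<in> X" using x bd_subset[of adj Y D X] by blast
      show ?thesis
      proof (cases "\<exists>y'\<in>Y - X. adj x y' \<and> y' \<noteq> y")
        case True
        \<comment> \<open>Since \<open>x\<close> keeps another neighbour outside \<open>X\<close>,
          the boundary of \<open>X\<close> survives the deletion of the edge. A larger set can lose
          only \<open>x\<close> from its boundary; strictly between \<open>X\<close> and
          \<open>Y\<close> the boundary was larger by at least one, and for \<open>Y\<close> it is
          \<open>D\<close> anyway.\<close>
        define adj' where "adj' a b \<longleftrightarrow> adj a b \<and> {a, b} \<noteq> {x, y}" for a b
        have sy': "symp adj'"
        proof (rule sympI)
          fix a b assume ab: "adj' a b"
          then have "adj b a" using sympD[OF sy, of a b] unfolding adj'_def by simp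
          moreover have "{b, a} \<noteq> {x, y}" using ab unfolding adj'_def by (simp add: insert_commute)
          ultimately show "adj' b a" unfolding adj'_def by simp
        qed
        have bX: "bd adj' Y D X = ?b X"
        proof -
          obtain y' where "y' \<in> Y - X" "adj x y'" "y' \<noteq> y" using True by blast
          then have "adj' x y'" using y xX unfolding adj'_def by auto
          then have "x \<in> bd adj' Y D X" using \<open>y' \<in> Y - X\<close> xX unfolding bd_def by blast
          moreover have "z \<in> bd adj' Y D X \<longleftrightarrow> z \<in> ?b X" if "z \<noteq> x" for z
            using that y xX unfolding bd_def adj'_def by (auto simp: doubleton_eq_iff)
          ultimately show ?thesis using x by (intro set_eqI) metis
        qed
        have bound: "card (bd adj' Y D X) \<le> card (bd adj' Y D Z)" if Z: "X \<subseteq> Z" "Z \<subseteq> Y" for Z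
        proof -
          have sub: "?b Z \<subseteq> insert x (bd adj' Y D Z)"
            using xX Z unfolding bd_def adj'_def by (auto simp: doubleton_eq_iff)
          have le: "card (?b X) \<le> card (?b Z)" using less.prems(5)[OF Z] .
          have fb': "finite (bd adj' Y D Z)"
            using Z fY bd_subset[of adj' Y D Z] by (meson finite_subset)
          consider "Z = X" | "Z = Y" | "X \<subset> Z" "Z \<subset> Y" using Z by blast
          then show ?thesis
          proof cases
            case 1
            then show ?thesis by simp
          next
            case 2
            then have "bd adj' Y D Z = ?b Z" unfolding bd_def by blast
            then show ?thesis using le bX by simp
          next
            case 3
            then have "card (?b Z) \<noteq> card (?b X)" using no by blast
            then have "card (?b X) < card (?b Z)" using le by linarith
            also have "card (?b Z) \<le> card (insert x (bd adj' Y D Z))"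
              using sub fb' by (intro card_mono) auto
            also have "\<dots> \<le> Suc (card (bd adj' Y D Z))"
              by (rule card_insert_le_m1) auto
            finally show ?thesis using bX by simp
          qed
        qed
        have fin: "finite {(a, b). a \<in> Y \<and> b \<in> Y \<and> adj a b}"
          by (rule finite_subset[of _ "Y \<times> Y"]) (use fY in auto)
        have "(x, y) \<in> {(a, b). a \<in> Y \<and> b \<in> Y \<and> adj a b} - {(a, b). a \<in> Y \<and> b \<in> Y \<and> adj' a b}"
          using xX y less.prems(4) unfolding adj'_def by auto
        moreover have "{(a, b). a \<in> Y \<and> b \<in> Y \<and> adj' a b} \<subseteq> {(a, b). a \<in> Y \<and> b \<in> Y \<and> adj a b}"
          unfolding adj'_def by auto
        ultimately have "card {(a, b). a \<in> Y \<and> b \<in> Y \<and> adj' a b} < card {(a, b). a \<in> Y \<and> b \<in> Y \<and> adj a b}"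
          by (intro psubset_card_mono fin) blast
        then have lt: "card (Y - X) + card {(a, b). a \<in> Y \<and> b \<in> Y \<and> adj' a b}
            < card (Y - X) + card {(a, b). a \<in> Y \<and> b \<in> Y \<and> adj a b}" by simp
        have cn: "conn adj A" if "conn adj' A" for A
          using that by (rule conn_mono) (simp add: adj'_def)
        have l: "linked adj' Y D X" by (rule less.hyps[OF lt fY sy' less.prems(3,4) bound])
        show ?thesis
        proof (rule linkedE[OF l, unfolded bX])
          fix P
          assume "\<And>x. x \<in> ?b X \<Longrightarrow> P x \<inter> X = {x} \<and> conn adj' (P x) \<and> P x \<subseteq> Y \<and> P x \<inter> D \<noteq> {}"
            and "\<And>x x'. x \<in> ?b X \<Longrightarrow> x' \<in> ?b X \<Longrightarrow> x \<noteq> x' \<Longrightarrow> P x \<inter> P x' = {}"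
          then show ?thesis using cn by (intro linkedI[of _ _ _ _ P]) simp_all
        qed
      next
        case only: False
        \<comment> \<open>As \<open>y\<close> is the only exit of \<open>x\<close>, moving it into
          \<open>X\<close> trades \<open>x\<close> for \<open>y\<close> and the boundary does not
          grow. By \<open>no\<close> this forces \<open>?Z = Y\<close>, whose boundary is
          \<open>D\<close>; so the edge from \<open>x\<close> to \<open>y\<close> completes a
          linkage of singletons.\<close>
        let ?Z = "insert y X"
        have sub: "?b ?Z \<subseteq> insert y (?b X - {x})"
          using only x(2) unfolding bd_def by blast
        have fX: "finite (?b X)" using fb[OF less.prems(4)] .
        have "y \<notin> ?b X - {x}" using y bd_subset[of adj Y D X] by blast
        then have "card (insert y (?b X - {x})) = card (?b X)"
          using card_Suc_Diff1[OF fX x(1)] fX by (metis card_insert_disjoint finite_Diff)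
        moreover have "card (?b X) \<le> card (?b ?Z)"
          by (rule less.prems(5)) (use y less.prems(4) in auto)
        moreover have "finite (insert y (?b X - {x}))" using fX by simp
        ultimately have eq: "?b ?Z = insert y (?b X - {x})" "card (?b ?Z) = card (?b X)"
          using card_seteq[OF _ sub] by auto
        then have "?Z = Y" using no y less.prems(4) by blast
        then have "?b ?Z = D" using less.prems(3) unfolding bd_def by blast
        then have D: "D = insert y (?b X - {x})" using eq by simp
        define P where "P = (\<lambda>z. if z = x then {x, y} else {z})"
        have "conn adj ({x} \<union> {y})"
          using conn_Un_edge[OF sy conn_singleton conn_singleton, of x x y y] y by blast
        then have "conn adj (P z)" for z
          unfolding P_def by (simp add: conn_singleton insert_commute)
        moreover have "z \<in> X \<and> (z \<noteq> x \<longrightarrow> z \<in> D)" if "z \<in> ?b X" for z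
          using that D bd_subset[of adj Y D X] by blast
        ultimately show ?thesis
          using D y xX less.prems(4)
          by (intro linkedI[of _ _ _ _ P]) (auto simp: P_def)
      qed
    qed
  qed
qed

subsection \<open>Rooted forest models\<close>

definition model :: "('a \<Rightarrow> 'a \<Rightarrow> bool) \<Rightarrow> ('b \<Rightarrow> 'b \<Rightarrow> bool) \<Rightarrow> 'b set \<Rightarrow> ('b \<Rightarrow> 'a set) \<Rightarrow> bool" where
  "model adj f W \<mu> \<longleftrightarrow> (\<forall>u\<in>W. conn adj (\<mu> u)) \<and>
    (\<forall>u\<in>W. \<forall>w\<in>W. u \<noteq> w \<longrightarrow> \<mu> u \<inter> \<mu> w = {} \<and> (f u w \<longrightarrow> (\<exists>x\<in>\<mu> u. \<exists>y\<in>\<mu> w. adj x y)))"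

lemma modelI:
  assumes "\<And>u. u \<in> W \<Longrightarrow> conn adj (\<mu> u)"
    and "\<And>u w. u \<in> W \<Longrightarrow> w \<in> W \<Longrightarrow> u \<noteq> w \<Longrightarrow> \<mu> u \<inter> \<mu> w = {}"
    and "\<And>u w. u \<in> W \<Longrightarrow> w \<in> W \<Longrightarrow> u \<noteq> w \<Longrightarrow> f u w \<Longrightarrow> \<exists>x\<in>\<mu> u. \<exists>y\<in>\<mu> w. adj x y"
  shows "model adj f W \<mu>"
  unfolding model_def using assms by simp

lemma modelD:
  assumes "model adj f W \<mu>"
  shows "u \<in> W \<Longrightarrow> conn adj (\<mu> u)"
    and "u \<in> W \<Longrightarrow> w \<in> W \<Longrightarrow> u \<noteq> w \<Longrightarrow> \<mu> u \<inter> \<mu> w = {}"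
    and "u \<in> W \<Longrightarrow> w \<in> W \<Longrightarrow> u \<noteq> w \<Longrightarrow> f u w \<Longrightarrow> \<exists>x\<in>\<mu> u. \<exists>y\<in>\<mu> w. adj x y"
  using assms unfolding model_def by simp_all

text \<open>1-degeneracy: this is the only way in which forests enter the argument.\<close>

inductive degenerate :: "('b \<Rightarrow> 'b \<Rightarrow> bool) \<Rightarrow> 'b set \<Rightarrow> bool" for f where
  empty: "degenerate f {}"
| insert: "degenerate f W \<Longrightarrow> v \<notin> W \<Longrightarrow> (\<And>u w. u \<in> W \<Longrightarrow> w \<in> W \<Longrightarrow> f v u \<Longrightarrow> f v w \<Longrightarrow> u = w)
    \<Longrightarrow> degenerate f (insert v W)"

lemma degenerate_finite: "degenerate f W \<Longrightarrow> finite W"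
  by (induction rule: degenerate.induct) auto

section \<open>Boundaries and chains of sets with small boundary\<close>

abbreviation boundary :: "('a \<Rightarrow> 'a \<Rightarrow> bool) \<Rightarrow> 'a set \<Rightarrow> 'a set \<Rightarrow> 'a set" where
  "boundary adj V \<equiv> bd adj V {}"

text \<open>Prepares \<open>linkage\<close> inside \<open>Y\<close> with the boundary of
  \<open>Y\<close> as target: the edges to \<open>V - Y\<close>, invisible inside \<open>Y\<close>,
  are remembered by the target.\<close>

lemma bd_boundary:
  assumes "Z \<subseteq> Y" "Y \<subseteq> V"
  shows "bd adj Y (boundary adj V Y) Z = boundary adj V Z"
proof (intro set_eqI iffI)
  fix z assume "z \<in> bd adj Y (boundary adj V Y) Z"
  then show "z \<in> boundary adj V Z" using assms unfolding bd_def by blast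
next
  fix z assume "z \<in> boundary adj V Z"
  then show "z \<in> bd adj Y (boundary adj V Y) Z" using assms unfolding bd_def by blast
qed

text \<open>A vertex in one of the boundaries on the left lies in one of those on the right, and a
  vertex in both of the former lies in both of the latter.\<close>

lemma boundary_submodular:
  assumes "finite A" "finite B"
  shows "card (boundary adj V (A \<inter> B)) + card (boundary adj V (A \<union> B))
    \<le> card (boundary adj V A) + card (boundary adj V B)"
proof -
  let ?b = "boundary adj V"
  have fin: "finite (?b Z)" if "finite Z" for Z
    using that bd_subset[of adj V "{}" Z] by (rule finite_subset[rotated])
  have f: "finite (?b A)" "finite (?b B)" "finite (?b (A \<inter> B))" "finite (?b (A \<union> B))"
    using assms by (simp_all add: fin)
  have "card (?b (A \<inter> B)) + card (?b (A \<union> B))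
      = card (?b (A \<inter> B) \<union> ?b (A \<union> B)) + card (?b (A \<inter> B) \<inter> ?b (A \<union> B))"
    using card_Un_Int[OF f(3,4)] .
  also have "\<dots> \<le> card (?b A \<union> ?b B) + card (?b A \<inter> ?b B)"
    using f by (intro add_mono card_mono) (auto simp: bd_def)
  also have "\<dots> = card (?b A) + card (?b B)"
    using card_Un_Int[OF f(1,2)] by simp
  finally show ?thesis .
qed

text \<open>Only the vertices of \<open>R\<close> are counted in a step; arbitrarily many others may be added
  at once. This is what makes the resulting decomposition ignore the part of the graph that is
  not linked to \<open>R\<close>.\<close>

inductive good :: "('a \<Rightarrow> 'a \<Rightarrow> bool) \<Rightarrow> 'a set \<Rightarrow> 'a set \<Rightarrow> nat \<Rightarrow> 'a set \<Rightarrow> bool" for adj V R k where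
  empty: "good adj V R k {}"
| step: "good adj V R k X \<Longrightarrow> X \<subseteq> Y \<Longrightarrow> Y \<subseteq> V \<Longrightarrow> card (boundary adj V Y) \<le> k \<Longrightarrow>
    card (R \<inter> (Y - X)) \<le> k \<Longrightarrow> good adj V R k Y"

lemma good_subset: "good adj V R k X \<Longrightarrow> X \<subseteq> V"
  by (induction rule: good.induct) auto

text \<open>Intersect each set of the chain with \<open>Z\<close>. The union of such a set with
  \<open>Z\<close> has a boundary no smaller than that of \<open>Z\<close>, so by submodularity the
  intersection has a boundary no larger than that of the set. The number of new vertices of
  \<open>R\<close> can only drop.\<close>

lemma good_Int:
  assumes "good adj V R k Y" "finite V" "Z \<subseteq> V" "card (boundary adj V Z) \<le> k"
    and "\<And>Z'. Z \<subseteq> Z' \<Longrightarrow> Z' \<subseteq> Z \<union> Y \<Longrightarrow> card (boundary adj V Z) \<le> card (boundary adj V Z')"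
  shows "good adj V R k (Y \<inter> Z)"
  using assms(1,5)
proof (induction rule: good.induct)
  case empty
  then show ?case by (simp add: good.empty)
next
  case (step X Y)
  have fin: "finite Y" "finite Z" using step.hyps assms(2,3) by (auto intro: finite_subset)
  have "card (boundary adj V Z) \<le> card (boundary adj V (Y \<union> Z))"
    by (rule step.prems) auto
  then have "card (boundary adj V (Y \<inter> Z)) \<le> card (boundary adj V Y)"
    using boundary_submodular[OF fin, of adj V] by linarith
  moreover have "good adj V R k (X \<inter> Z)"
    using step.prems step.hyps(2) by (intro step.IH) blast
  moreover have "card (R \<inter> (Y \<inter> Z - X \<inter> Z)) \<le> card (R \<inter> (Y - X))"
    using fin by (intro card_mono) auto
  moreover have "X \<inter> Z \<subseteq> Y \<inter> Z" "Y \<inter> Z \<subseteq> V" using step.hyps(2,3) by blast+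
  ultimately show ?case
    using step.hyps(4,5) by (intro good.step[of _ _ _ _ "X \<inter> Z" "Y \<inter> Z"]) linarith+
qed

text \<open>Diestel's proof of the path-width theorem. The maximality of \<open>X\<close> guarantees that a new
  vertex \<open>y\<close>, chosen next to the branch set that has to be extended, enlarges the boundary of
  every good superset, so all old branch sets can be linked on to the next maximal set.\<close>

lemma grow_model:
  fixes adj :: "'a \<Rightarrow> 'a \<Rightarrow> bool" and f :: "'b \<Rightarrow> 'b \<Rightarrow> bool"
  assumes "degenerate f W" "finite V" "symp adj" "symp f" "\<not> good adj V R k V" "card W \<le> k"
  shows "\<exists>X \<mu>. good adj V R k X \<and> card (boundary adj V X) \<le> card W \<and>
    (\<forall>Y. good adj V R k Y \<longrightarrow> X \<subset> Y \<longrightarrow> card W < card (boundary adj V Y)) \<and>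
    model adj f W \<mu> \<and> (\<forall>u\<in>W. \<mu> u \<subseteq> X \<and> \<mu> u \<inter> boundary adj V X \<noteq> {})"
  using assms(1,6)
proof (induction rule: degenerate.induct)
  let ?b = "boundary adj V"
  have maximal: "\<exists>Y. good adj V R k Y \<and> X \<subseteq> Y \<and> card (?b Y) \<le> n \<and>
      (\<forall>Y'. good adj V R k Y' \<longrightarrow> Y \<subset> Y' \<longrightarrow> n < card (?b Y'))"
    if "good adj V R k X" "card (?b X) \<le> n" for X n
  proof -
    let ?S = "{Y. good adj V R k Y \<and> X \<subseteq> Y \<and> card (?b Y) \<le> n}"
    have "finite ?S" by (rule finite_subset[of _ "Pow V"]) (use assms(2) in \<open>auto dest: good_subset\<close>)
    moreover have "X \<in> ?S" using that by simp
    ultimately obtain Y where Y: "Y \<in> ?S" "\<forall>Y'\<in>?S. Y \<subseteq> Y' \<longrightarrow> Y = Y'"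
      using finite_has_maximal2[of ?S X] by blast
    have "n < card (?b Y')" if "good adj V R k Y'" "Y \<subset> Y'" for Y'
    proof (rule ccontr)
      assume "\<not> n < card (?b Y')"
      then have "Y' \<in> ?S" using Y(1) that by auto
      then show False using Y(2) that(2) by blast
    qed
    then show ?thesis using Y(1) by blast
  qed
  {
    case empty
    have "card (?b {}) \<le> 0" unfolding bd_def by simp
    then obtain X where "good adj V R k X" "card (?b X) \<le> 0"
        "\<forall>Y. good adj V R k Y \<longrightarrow> X \<subset> Y \<longrightarrow> 0 < card (?b Y)"
      using maximal[OF good.empty] by blast
    then show ?case by (intro exI[of _ X] exI[of _ "\<lambda>_. {}"]) (simp add: model_def)
  next
    case (insert W v)
    have fW: "finite W" using insert.hyps(1) by (rule degenerate_finite)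
    have cW: "card (insert v W) = Suc (card W)" using fW insert.hyps(2) by simp
    then obtain X \<mu> where X: "good adj V R k X" "card (?b X) \<le> card W"
      and max: "\<And>Y. good adj V R k Y \<Longrightarrow> X \<subset> Y \<Longrightarrow> card W < card (?b Y)"
      and \<mu>: "model adj f W \<mu>" "\<And>u. u \<in> W \<Longrightarrow> \<mu> u \<subseteq> X" "\<And>u. u \<in> W \<Longrightarrow> \<mu> u \<inter> ?b X \<noteq> {}"
      using insert.IH insert.prems by auto
    have XV: "X \<subseteq> V" "X \<noteq> V" using good_subset[OF X(1)] X(1) assms(5) by auto
    have "\<forall>u\<in>W. \<exists>x. x \<in> \<mu> u \<inter> ?b X" using \<mu>(3) by blast
    then obtain h where h: "\<And>u. u \<in> W \<Longrightarrow> h u \<in> \<mu> u" "\<And>u. u \<in> W \<Longrightarrow> h u \<in> ?b X"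
      by (metis IntD1 IntD2)
    \<comment> \<open>Degeneracy: at most one old branch set has to become adjacent to that of
      \<open>v\<close>, so a single new vertex next to its boundary vertex is enough. If there is
      none, any vertex outside \<open>X\<close> will do.\<close>
    obtain y where y: "y \<in> V" "y \<notin> X" and yadj: "\<And>u. u \<in> W \<Longrightarrow> f v u \<Longrightarrow> adj (h u) y"
    proof (cases "\<exists>u\<in>W. f v u")
      case True
      then obtain u where u: "u \<in> W" "f v u" by blast
      obtain y where "y \<in> V - X" "adj (h u) y" using h(2)[OF u(1)] unfolding bd_def by blast
      then show ?thesis using that[of y] insert.hyps(3)[OF _ u(1) _ u(2)] by blast
    next
      case False
      then show ?thesis using that XV by blast
    qed
    let ?X = "insert y X"
    have finV: "finite Z" if "Z \<subseteq> V" for Z using that assms(2) by (rule finite_subset)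
    have finb: "finite (?b Z)" if "Z \<subseteq> V" for Z
      using bd_subset[of adj V "{}" Z] finV[OF that] by (rule finite_subset)
    have bX': "?b ?X \<subseteq> insert y (?b X)" unfolding bd_def by blast
    have cX': "card (?b ?X) \<le> Suc (card W)"
    proof -
      have "card (?b ?X) \<le> card (insert y (?b X))"
        using bX' finb[OF XV(1)] by (intro card_mono) auto
      also have "\<dots> \<le> Suc (card (?b X))" by (rule card_insert_le_m1) auto
      finally show ?thesis using X(2) by linarith
    qed
    have gX': "good adj V R k ?X"
    proof (rule good.step[OF X(1)])
      have "card (R \<inter> (?X - X)) \<le> card {y}" by (intro card_mono) auto
      then show "card (R \<inter> (?X - X)) \<le> k" using insert.prems cW by simp
      show "card (?b ?X) \<le> k" using cX' insert.prems cW by linarith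
    qed (use y XV in auto)
    obtain Y where Y: "good adj V R k Y" "?X \<subseteq> Y" "card (?b Y) \<le> Suc (card W)"
      and Ymax: "\<forall>Y'. good adj V R k Y' \<longrightarrow> Y \<subset> Y' \<longrightarrow> Suc (card W) < card (?b Y')"
      using maximal[OF gX' cX'] by blast
    have YV: "Y \<subseteq> V" using Y(1) by (rule good_subset)
    \<comment> \<open>A set of least boundary between \<open>?X\<close> and \<open>Y\<close> is
      itself good by \<open>good_Int\<close>. It properly contains \<open>X\<close>, so the
      maximality of \<open>X\<close> bounds its boundary from below.\<close>
    have lower: "Suc (card W) \<le> card (?b Z)" if Z: "?X \<subseteq> Z" "Z \<subseteq> Y" for Z
    proof -
      obtain Z0 where Z0: "?X \<subseteq> Z0 \<and> Z0 \<subseteq> Y"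
        and min: "\<And>Z'. ?X \<subseteq> Z' \<and> Z' \<subseteq> Y \<Longrightarrow> card (?b Z0) \<le> card (?b Z')"
        using ex_has_least_nat[of "\<lambda>Z. ?X \<subseteq> Z \<and> Z \<subseteq> Y" Z "\<lambda>Z. card (?b Z)"] Z by blast
      have "good adj V R k (Y \<inter> Z0)"
      proof (rule good_Int[OF Y(1) assms(2)])
        show "Z0 \<subseteq> V" using Z0 YV by blast
        have "card (?b Z0) \<le> Suc (card W)" using min[of Y] Y by auto
        then show "card (?b Z0) \<le> k" using insert.prems cW by linarith
        show "card (?b Z0) \<le> card (?b Z')" if "Z0 \<subseteq> Z'" "Z' \<subseteq> Z0 \<union> Y" for Z'
          by (rule min) (use that Z0 in blast)
      qed
      moreover have "Y \<inter> Z0 = Z0" using Z0 by blast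
      ultimately have "card W < card (?b Z0)" using max[of Z0] Z0 y by auto
      then show ?thesis using min[of Z] Z by linarith
    qed
    have cX'eq: "card (?b ?X) = Suc (card W)" using lower[of ?X] cX' Y(2) by auto
    \<comment> \<open>The count leaves no slack: \<open>y\<close> and all old boundary vertices,
      among them each \<open>h u\<close>, remain in the boundary and therefore receive a linking
      set.\<close>
    have bX'eq: "?b ?X = insert y (?b X)"
    proof (rule card_seteq[OF _ bX'])
      show "finite (insert y (?b X))" using finb[OF XV(1)] by simp
      have "card (insert y (?b X)) \<le> Suc (card (?b X))" by (rule card_insert_le_m1) auto
      then show "card (insert y (?b X)) \<le> card (?b ?X)" using cX'eq X(2) by linarith
    qed
    have e: "bd adj Y (?b Y) ?X = ?b ?X" using bd_boundary[OF Y(2) YV] .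
    have l: "linked adj Y (?b Y) ?X"
    proof (rule linkage[OF finV[OF YV] assms(3) bd_subset Y(2)])
      fix Z assume Z: "?X \<subseteq> Z" "Z \<subseteq> Y"
      have "bd adj Y (?b Y) Z = ?b Z" using bd_boundary[OF Z(2) YV] .
      then show "card (bd adj Y (?b Y) ?X) \<le> card (bd adj Y (?b Y) Z)"
        using e lower[OF Z] cX'eq by simp
    qed
    obtain P where P: "\<And>x. x \<in> ?b ?X \<Longrightarrow> P x \<inter> ?X = {x} \<and> conn adj (P x) \<and> P x \<subseteq> Y \<and> P x \<inter> ?b Y \<noteq> {}"
      "\<And>x x'. x \<in> ?b ?X \<Longrightarrow> x' \<in> ?b ?X \<Longrightarrow> x \<noteq> x' \<Longrightarrow> P x \<inter> P x' = {}"
      using linkedE[OF l, unfolded e] by blast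
    have yb: "y \<in> ?b ?X" using bX'eq by blast
    have hb: "h u \<in> ?b ?X" if "u \<in> W" for u using bX'eq h(2)[OF that] by blast
    define \<nu> where "\<nu> = (\<lambda>u. if u = v then P y else \<mu> u \<union> P (h u))"
    have \<nu>v: "\<nu> v = P y" unfolding \<nu>_def by simp
    have \<nu>: "\<nu> u = \<mu> u \<union> P (h u)" if "u \<in> W" for u
      using that insert.hyps(2) unfolding \<nu>_def by auto
    have inP: "x \<in> P x" if "x \<in> ?b ?X" for x using P(1)[OF that] by blast
    have PX: "x' = x" if "x \<in> ?b ?X" "x' \<in> P x" "x' \<in> ?X" for x x'
      using P(1)[OF that(1)] that(2,3) by blast
    have sep: "\<mu> u \<inter> P x = {}" if "u \<in> W" "x \<in> ?b ?X" "x \<notin> \<mu> u" for u x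
      using PX[OF that(2)] \<mu>(2)[OF that(1)] that(3) by blast
    have ynot: "y \<notin> \<mu> u" if "u \<in> W" for u using \<mu>(2)[OF that] y by blast
    have hdiff: "h u \<notin> \<mu> w" if "u \<in> W" "w \<in> W" "u \<noteq> w" for u w
      using modelD(2)[OF \<mu>(1) that] h(1)[OF that(1)] by blast
    have cn: "conn adj (\<nu> u)" if "u \<in> insert v W" for u
    proof (cases "u = v")
      case True
      then show ?thesis using \<nu>v P(1)[OF yb] by simp
    next
      case False
      then have u: "u \<in> W" using that by simp
      have "conn adj (P (h u))" using P(1)[OF hb[OF u]] by blast
      then show ?thesis
        using conn_Un[OF modelD(1)[OF \<mu>(1) u] _ h(1)[OF u] inP[OF hb[OF u]]] \<nu>[OF u] by simp
    qed
    have dv: "\<nu> u \<inter> \<nu> v = {}" if "u \<in> W" for u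
    proof -
      have "h u \<noteq> y" using h(1)[OF that] ynot[OF that] by blast
      then show ?thesis
        using sep[OF that yb ynot[OF that]] P(2)[OF hb[OF that] yb] \<nu>[OF that] \<nu>v by blast
    qed
    have dw: "\<nu> u \<inter> \<nu> w = {}" if uw: "u \<in> W" "w \<in> W" "u \<noteq> w" for u w
    proof -
      have "h u \<noteq> h w" using hdiff[OF uw] h(1)[OF uw(2)] by metis
      then have "P (h u) \<inter> P (h w) = {}" using P(2) hb uw by blast
      moreover have "\<mu> u \<inter> P (h w) = {}" using sep hb hdiff uw by metis
      moreover have "\<mu> w \<inter> P (h u) = {}" using sep hb hdiff uw by metis
      ultimately show ?thesis using modelD(2)[OF \<mu>(1) uw] \<nu>[OF uw(1)] \<nu>[OF uw(2)] by blast
    qed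
    have vE: "\<exists>x\<in>\<nu> u. \<exists>y\<in>\<nu> v. adj x y" if "u \<in> W" "f v u" for u
      using yadj[OF that] h(1)[OF that(1)] inP[OF yb] \<nu>[OF that(1)] \<nu>v by blast
    have WE: "\<exists>x\<in>\<nu> u. \<exists>y\<in>\<nu> w. adj x y" if "u \<in> W" "w \<in> W" "u \<noteq> w" "f u w" for u w
      using modelD(3)[OF \<mu>(1) that] \<nu>[OF that(1)] \<nu>[OF that(2)] by blast
    have "model adj f (insert v W) \<nu>"
    proof (rule modelI)
      fix u w assume uw: "u \<in> insert v W" "w \<in> insert v W" "u \<noteq> w"
      then show "\<nu> u \<inter> \<nu> w = {}" using dv[of u] dv[of w] dw[of u w] by blast
      assume f: "f u w"
      consider "u = v" "w \<in> W" | "u \<in> W" "w = v" | "u \<in> W" "w \<in> W" using uw by blast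
      then show "\<exists>x\<in>\<nu> u. \<exists>y\<in>\<nu> w. adj x y"
      proof cases
        case 1
        then obtain x y where "x \<in> \<nu> w" "y \<in> \<nu> v" "adj x y" using vE[of w] f by blast
        then show ?thesis using 1(1) sympD[OF assms(3), of x y] by blast
      next
        case 2
        then have "f v u" using f sympD[OF assms(4), of u w] by simp
        then show ?thesis using vE[of u] 2 by simp
      next
        case 3
        then show ?thesis using WE uw(3) f by simp
      qed
    qed (rule cn)
    moreover have "\<nu> u \<subseteq> Y \<and> \<nu> u \<inter> ?b Y \<noteq> {}" if "u \<in> insert v W" for u
    proof (cases "u = v")
      case True
      then show ?thesis using \<nu>v P(1)[OF yb] by simp
    next
      case False
      then have u: "u \<in> W" using that by simp
      have "\<mu> u \<subseteq> Y" using \<mu>(2)[OF u] Y(2) by blast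
      then show ?thesis using P(1)[OF hb[OF u]] \<nu>[OF u] by auto
    qed
    ultimately show ?case
      using Y(1,3) Ymax cW by (intro exI[of _ Y] exI[of _ \<nu>]) simp
  }
qed

text \<open>By maximality of \<open>X\<close>, its boundary cannot be separated from \<open>R - X\<close> by fewer than
  \<open>card W\<close> vertices, so the branch sets can be prolonged until each of them meets \<open>R\<close>.\<close>

theorem rooted_model_or_good:
  fixes adj :: "'a \<Rightarrow> 'a \<Rightarrow> bool" and f :: "'b \<Rightarrow> 'b \<Rightarrow> bool"
  assumes "degenerate f W" "finite V" "symp adj" "symp f" "\<not> good adj V R (card W) V" "R \<subseteq> V"
  obtains \<mu> where "model adj f W \<mu>" "\<And>u. u \<in> W \<Longrightarrow> \<mu> u \<subseteq> V" "\<And>u. u \<in> W \<Longrightarrow> \<mu> u \<inter> R \<noteq> {}"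
proof -
  let ?k = "card W" and ?b = "boundary adj V"
  obtain X \<mu> where X: "good adj V R ?k X" "card (?b X) \<le> ?k"
    and max: "\<And>Y. good adj V R ?k Y \<Longrightarrow> X \<subset> Y \<Longrightarrow> ?k < card (?b Y)"
    and \<mu>: "model adj f W \<mu>" "\<And>u. u \<in> W \<Longrightarrow> \<mu> u \<subseteq> X" "\<And>u. u \<in> W \<Longrightarrow> \<mu> u \<inter> ?b X \<noteq> {}"
    using grow_model[OF assms(1-5) order_refl] by auto
  have XV: "X \<subseteq> V" using X(1) by (rule good_subset)
  have finV: "finite Z" if "Z \<subseteq> V" for Z using that assms(2) by (rule finite_subset)
  have finb: "finite (bd adj V D Z)" if "Z \<subseteq> V" for Z D
    using bd_subset[of adj V D Z] finV[OF that] by (rule finite_subset)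
  let ?D = "R - X"
  have "\<forall>u\<in>W. \<exists>x. x \<in> \<mu> u \<inter> ?b X" using \<mu>(3) by blast
  then obtain h where h: "\<And>u. u \<in> W \<Longrightarrow> h u \<in> \<mu> u" "\<And>u. u \<in> W \<Longrightarrow> h u \<in> ?b X"
    by (metis IntD1 IntD2)
  have hdiff: "h u \<notin> \<mu> w" if "u \<in> W" "w \<in> W" "u \<noteq> w" for u w
    using modelD(2)[OF \<mu>(1) that] h(1)[OF that(1)] by blast
  have "inj_on h W" using hdiff h(1) by (intro inj_onI) metis
  then have "?k \<le> card (?b X)"
    using card_mono[OF finb[OF XV], of "h ` W" "{}"] h(2) by (auto simp: card_image)
  then have cX: "card (?b X) = ?k" using X(2) by simp
  have e: "bd adj V ?D X = ?b X" unfolding bd_def by blast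
  have l: "linked adj V ?D X"
  proof (rule linkage[OF assms(2,3) _ XV])
    fix Z assume Z: "X \<subseteq> Z" "Z \<subseteq> V"
    \<comment> \<open>A smaller separator \<open>Z\<close> would be a legal next set of the chain,
      since its boundary and the new vertices of \<open>R\<close> in it all lie in
      \<open>bd adj V ?D Z\<close>. This contradicts the maximality of \<open>X\<close>.\<close>
    have "?k \<le> card (bd adj V ?D Z)"
    proof (rule ccontr)
      assume lt: "\<not> ?thesis"
      have "card (?b Z) \<le> card (bd adj V ?D Z)"
        using finb[OF Z(2), of ?D] by (intro card_mono) (auto simp: bd_def)
      moreover have "card (R \<inter> (Z - X)) \<le> card (bd adj V ?D Z)"
        using finb[OF Z(2), of ?D] by (intro card_mono) (auto simp: bd_def)
      ultimately have "good adj V R ?k Z" and less: "card (?b Z) < ?k"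
        using lt Z by (auto intro!: good.step[OF X(1)])
      then show False using max[of Z] Z cX by (cases "Z = X") auto
    qed
    then show "card (bd adj V ?D X) \<le> card (bd adj V ?D Z)" using e cX by simp
  qed (use assms(6) in blast)
  obtain P where P: "\<And>x. x \<in> ?b X \<Longrightarrow> P x \<inter> X = {x} \<and> conn adj (P x) \<and> P x \<subseteq> V \<and> P x \<inter> ?D \<noteq> {}"
    "\<And>x x'. x \<in> ?b X \<Longrightarrow> x' \<in> ?b X \<Longrightarrow> x \<noteq> x' \<Longrightarrow> P x \<inter> P x' = {}"
    using linkedE[OF l, unfolded e] by blast
  let ?\<nu> = "\<lambda>u. \<mu> u \<union> P (h u)"
  have sep: "\<mu> u \<inter> P (h w) = {}" if "u \<in> W" "w \<in> W" "u \<noteq> w" for u w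
  proof -
    have "h w \<notin> \<mu> u" using hdiff that by blast
    have "P (h w) \<inter> X = {h w}" using P(1)[OF h(2)[OF that(2)]] by simp
    then have "\<mu> u \<inter> P (h w) \<subseteq> \<mu> u \<inter> {h w}" using \<mu>(2)[OF that(1)] by blast
    then show ?thesis using \<open>h w \<notin> \<mu> u\<close> by blast
  qed
  have "model adj f W ?\<nu>"
  proof (rule modelI)
    fix u assume u: "u \<in> W"
    have "h u \<in> P (h u)" "conn adj (P (h u))" using P(1)[OF h(2)[OF u]] by blast+
    then show "conn adj (?\<nu> u)" using conn_Un[OF modelD(1)[OF \<mu>(1) u] _ h(1)[OF u]] by blast
  next
    fix u w assume uw: "u \<in> W" "w \<in> W" "u \<noteq> w"
    have "h u \<noteq> h w" using hdiff[OF uw] h(1)[OF uw(2)] by metis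
    then have "P (h u) \<inter> P (h w) = {}" using P(2) h(2) uw by blast
    then show "?\<nu> u \<inter> ?\<nu> w = {}"
      using sep[OF uw] sep[OF uw(2,1)] uw(3) modelD(2)[OF \<mu>(1) uw] by blast
  next
    fix u w assume "u \<in> W" "w \<in> W" "u \<noteq> w" "f u w"
    then show "\<exists>x\<in>?\<nu> u. \<exists>y\<in>?\<nu> w. adj x y" using modelD(3)[OF \<mu>(1)] by blast
  qed
  moreover have "?\<nu> u \<subseteq> V" "?\<nu> u \<inter> R \<noteq> {}" if "u \<in> W" for u
    using P(1)[OF h(2)[OF that]] \<mu>(2)[OF that] XV by blast+
  ultimately show ?thesis by (rule that)
qed

subsection \<open>Path decompositions\<close>

text \<open>The interval condition in recursive form, which suits the insertion of bags into a list.
  Comparing with the next bag is enough because later gaps are excluded recursively.\<close>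

fun contiguous :: "'a \<Rightarrow> 'a set list \<Rightarrow> bool" where
  "contiguous v [] \<longleftrightarrow> True"
| "contiguous v (B # P) \<longleftrightarrow> contiguous v P \<and> (v \<in> B \<and> v \<in> \<Union>(set P) \<longrightarrow> v \<in> hd P)"

lemma contiguous_nth:
  assumes "contiguous v P" "i \<le> j" "j \<le> k" "k < length P" "v \<in> P ! i" "v \<in> P ! k"
  shows "v \<in> P ! j"
  using assms
proof (induction P arbitrary: i j k)
  case Nil
  then show ?case by simp
next
  case (Cons B P)
  show ?case
  proof (cases j)
    case 0
    then show ?thesis using Cons.prems by simp
  next
    case (Suc j')
    then obtain k' where k': "k = Suc k'" "j' \<le> k'" "k' < length P" "v \<in> P ! k'"
      using Cons.prems by (cases k) auto
    show ?thesis
    proof (cases i)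
      case 0
      have "P \<noteq> []" using k'(3) by auto
      have "v \<in> \<Union>(set P)" using k'(3,4) nth_mem by blast
      then have "v \<in> hd P" using Cons.prems(1,5) 0 by simp
      then have "v \<in> P ! 0" using \<open>P \<noteq> []\<close> by (simp add: hd_conv_nth)
      then show ?thesis using Cons.IH[of 0 j' k'] Cons.prems(1) k' Suc by simp
    next
      case (Suc i')
      then show ?thesis using Cons.IH[of i' j' k'] Cons.prems k' \<open>j = Suc j'\<close> by simp
    qed
  qed
qed

lemma contiguous_notin: "v \<notin> \<Union>(set P) \<Longrightarrow> contiguous v P"
  by (induction P) auto

lemma contiguous_append_notin:
  "v \<notin> \<Union>(set P) \<Longrightarrow> contiguous v Q \<Longrightarrow> contiguous v (P @ Q)"
  by (induction P) auto

lemma contiguous_Diff: "v \<notin> K \<Longrightarrow> contiguous v P \<Longrightarrow> contiguous v (map (\<lambda>B. B - K) P)"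
proof (induction P)
  case (Cons B P)
  then show ?case by (cases P) auto
qed simp

text \<open>An old vertex lies in all inserted bags or in none, according to whether it is in
  \<open>B\<close>. As these bags directly follow \<open>B\<close>, its interval is stretched or
  left alone.\<close>

lemma contiguous_insert_old:
  assumes "v \<notin> \<Union>(set Q)" "contiguous v (P1 @ B # P2)"
  shows "contiguous v (P1 @ B # map (\<lambda>W. B \<union> W) Q @ P2)"
  using assms(2)
proof (induction P1)
  case Nil
  show ?case using assms(1)
  proof (induction Q)
    case Nil
    then show ?case using \<open>contiguous v ([] @ B # P2)\<close> by simp
  next
    case (Cons W Q)
    then show ?case by auto
  qed
next
  case (Cons A P1)
  have m: "v \<in> \<Union>(set (P1 @ B # map (\<lambda>W. B \<union> W) Q @ P2)) \<Longrightarrow> v \<in> \<Union>(set (P1 @ B # P2))"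
    using assms(1) by (auto split: if_splits)
  have h: "hd (P1 @ B # map (\<lambda>W. B \<union> W) Q @ P2) = hd (P1 @ B # P2)"
    by (cases P1) auto
  have a: "contiguous v (P1 @ B # P2)" "v \<in> A \<and> v \<in> \<Union>(set (P1 @ B # P2)) \<longrightarrow> v \<in> hd (P1 @ B # P2)"
    using Cons.prems unfolding append_Cons contiguous.simps by simp_all
  show ?case
    unfolding append_Cons contiguous.simps h
  proof (intro conjI impI)
    show "contiguous v (P1 @ B # map (\<lambda>W. B \<union> W) Q @ P2)" using Cons.IH[OF a(1)] .
    assume "v \<in> A \<and> v \<in> \<Union>(set (P1 @ B # map (\<lambda>W. B \<union> W) Q @ P2))"
    then show "v \<in> hd (P1 @ B # P2)" using m a(2) by (metis (no_types))
  qed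
qed

text \<open>A new vertex occurs only in the inserted block, and there exactly where it occurs in
  \<open>Q\<close>.\<close>

lemma contiguous_insert_new:
  assumes "v \<notin> \<Union>(set (P1 @ B # P2))" "contiguous v Q"
  shows "contiguous v (P1 @ B # map (\<lambda>W. B \<union> W) Q @ P2)"
proof (rule contiguous_append_notin)
  have "contiguous v (map (\<lambda>W. B \<union> W) Q @ P2)" using assms(2)
  proof (induction Q)
    case Nil
    then show ?case using assms(1) by (simp add: contiguous_notin)
  next
    case (Cons W Q)
    then show ?case using assms(1) by (cases Q) auto
  qed
  then show "contiguous v (B # map (\<lambda>W. B \<union> W) Q @ P2)" using assms(1) by auto
qed (use assms(1) in auto)

definition pathdec :: "('a \<Rightarrow> 'a \<Rightarrow> bool) \<Rightarrow> 'a set \<Rightarrow> 'a set list \<Rightarrow> bool" where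
  "pathdec adj U P \<longleftrightarrow> (\<forall>B\<in>set P. B \<subseteq> U) \<and>
    (\<forall>x\<in>U. \<forall>y\<in>U. adj x y \<longrightarrow> (\<exists>B\<in>set P. x \<in> B \<and> y \<in> B)) \<and>
    (\<forall>v\<in>U. v \<in> \<Union>(set P) \<and> contiguous v P)"

lemma pathdecI:
  assumes "\<And>B. B \<in> set P \<Longrightarrow> B \<subseteq> U"
    and "\<And>x y. x \<in> U \<Longrightarrow> y \<in> U \<Longrightarrow> adj x y \<Longrightarrow> \<exists>B\<in>set P. x \<in> B \<and> y \<in> B"
    and "\<And>v. v \<in> U \<Longrightarrow> v \<in> \<Union>(set P)" "\<And>v. v \<in> U \<Longrightarrow> contiguous v P"
  shows "pathdec adj U P"
  unfolding pathdec_def using assms by simp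

lemma pathdecD:
  assumes "pathdec adj U P"
  shows "B \<in> set P \<Longrightarrow> B \<subseteq> U"
    and "x \<in> U \<Longrightarrow> y \<in> U \<Longrightarrow> adj x y \<Longrightarrow> \<exists>B\<in>set P. x \<in> B \<and> y \<in> B"
    and "v \<in> U \<Longrightarrow> v \<in> \<Union>(set P)" "v \<in> U \<Longrightarrow> contiguous v P"
  using assms unfolding pathdec_def by simp_all

lemma pathdec_Diff:
  assumes "pathdec adj U P"
  shows "pathdec adj (U - K) (map (\<lambda>B. B - K) P)"
proof (rule pathdecI)
  fix B assume "B \<in> set (map (\<lambda>B. B - K) P)"
  then obtain B' where "B' \<in> set P" "B = B' - K" by auto
  then show "B \<subseteq> U - K" using pathdecD(1)[OF assms, of B'] by blast
next
  fix x y assume xy: "x \<in> U - K" "y \<in> U - K" "adj x y"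
  then obtain B where "B \<in> set P" "x \<in> B" "y \<in> B" using pathdecD(2)[OF assms, of x y] by blast
  then show "\<exists>B\<in>set (map (\<lambda>B. B - K) P). x \<in> B \<and> y \<in> B" using xy by auto
next
  fix v assume v: "v \<in> U - K"
  then show "v \<in> \<Union>(set (map (\<lambda>B. B - K) P))" using pathdecD(3)[OF assms, of v] by auto
  show "contiguous v (map (\<lambda>B. B - K) P)" using v pathdecD(4)[OF assms, of v] by (simp add: contiguous_Diff)
qed

text \<open>An edge between \<open>D\<close> and \<open>U\<close> has its end of \<open>U\<close> in
  \<open>B\<close> by \<open>nb\<close>, so it lies in \<open>B \<union> W\<close> for any bag
  \<open>W\<close> that contains the other end.\<close>

lemma pathdec_insert:
  assumes P: "pathdec adj U P" and Q: "pathdec adj D Q" and "symp adj" "D \<inter> U = {}" "B \<in> set P"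
    and nb: "\<And>x y. x \<in> D \<Longrightarrow> y \<in> U \<Longrightarrow> adj x y \<Longrightarrow> y \<in> B"
  shows "\<exists>P'. pathdec adj (U \<union> D) P' \<and> set P' = set P \<union> (\<lambda>W. B \<union> W) ` set Q"
proof -
  obtain P1 P2 where P12: "P = P1 @ B # P2" using split_list[OF assms(5)] by blast
  let ?P = "P1 @ B # map (\<lambda>W. B \<union> W) Q @ P2"
  have sP: "set ?P = set P \<union> (\<lambda>W. B \<union> W) ` set Q" using P12 by auto
  have BU: "B \<subseteq> U" using pathdecD(1)[OF P assms(5)] .
  have mixed: "\<exists>B\<in>set ?P. x \<in> B \<and> y \<in> B" if xy: "x \<in> D" "y \<in> U" "adj x y" for x y
  proof -
    obtain W where "W \<in> set Q" "x \<in> W" using pathdecD(3)[OF Q xy(1)] by blast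
    then have "B \<union> W \<in> set ?P" "x \<in> B \<union> W" "y \<in> B \<union> W" using sP nb[OF xy] by auto
    then show ?thesis by (intro bexI[of _ "B \<union> W"] conjI)
  qed
  have "pathdec adj (U \<union> D) ?P"
  proof (rule pathdecI)
    fix B' assume "B' \<in> set ?P"
    then consider "B' \<in> set P" | W where "W \<in> set Q" "B' = B \<union> W" unfolding sP by blast
    then show "B' \<subseteq> U \<union> D"
      using pathdecD(1)[OF P] pathdecD(1)[OF Q] BU by cases blast+
  next
    fix x y assume xy: "x \<in> U \<union> D" "y \<in> U \<union> D" "adj x y"
    then consider "x \<in> U" "y \<in> U" | "x \<in> D" "y \<in> D" | "x \<in> D" "y \<in> U" | "x \<in> U" "y \<in> D" by blast
    then show "\<exists>B\<in>set ?P. x \<in> B \<and> y \<in> B"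
    proof cases
      case 1
      then show ?thesis using pathdecD(2)[OF P _ _ xy(3)] unfolding sP by blast
    next
      case 2
      then obtain W where "W \<in> set Q" "x \<in> W" "y \<in> W" using pathdecD(2)[OF Q _ _ xy(3)] by blast
      then have "B \<union> W \<in> set ?P" "x \<in> B \<union> W" "y \<in> B \<union> W" unfolding sP by auto
      then show ?thesis by (intro bexI[of _ "B \<union> W"] conjI)
    next
      case 3
      then show ?thesis using mixed[OF _ _ xy(3)] by blast
    next
      case 4
      then show ?thesis using mixed[of y x] sympD[OF assms(3) xy(3)] by blast
    qed
  next
    fix v assume v: "v \<in> U \<union> D"
    show "v \<in> \<Union>(set ?P)"
      using v pathdecD(3)[OF P, of v] pathdecD(3)[OF Q, of v] unfolding sP by blast
    show "contiguous v ?P"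
    proof (cases "v \<in> U")
      case True
      then have "v \<notin> \<Union>(set Q)" using pathdecD(1)[OF Q] assms(4) by blast
      then show ?thesis using contiguous_insert_old[of v Q P1 B P2] pathdecD(4)[OF P True] P12 by simp
    next
      case False
      then have "v \<notin> \<Union>(set P)" "v \<in> D" using pathdecD(1)[OF P] v by blast+
      then show ?thesis using contiguous_insert_new[of v P1 B P2 Q] pathdecD(4)[OF Q, of v] P12 by simp
    qed
  qed
  then show ?thesis using sP by blast
qed

text \<open>A path decomposition of a part \<open>S\<close> of \<open>X\<close> such that each component of the rest
  attaches to \<open>S\<close> within a single bag.\<close>

definition spine :: "('a \<Rightarrow> 'a \<Rightarrow> bool) \<Rightarrow> 'a set \<Rightarrow> nat \<Rightarrow> 'a set \<Rightarrow> 'a set list \<Rightarrow> bool" where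
  "spine adj X k S P \<longleftrightarrow> S \<subseteq> X \<and> pathdec adj S P \<and> (\<forall>B\<in>set P. card B \<le> k) \<and>
    (\<forall>D. conn adj D \<and> D \<subseteq> X - S \<longrightarrow> (\<exists>B\<in>set P. \<forall>x\<in>D. \<forall>y\<in>S. adj x y \<longrightarrow> y \<in> B))"

lemma spineI:
  assumes "S \<subseteq> X" "pathdec adj S P" "\<And>B. B \<in> set P \<Longrightarrow> card B \<le> k"
    and "\<And>D. conn adj D \<Longrightarrow> D \<subseteq> X - S \<Longrightarrow> \<exists>B\<in>set P. \<forall>x\<in>D. \<forall>y\<in>S. adj x y \<longrightarrow> y \<in> B"
  shows "spine adj X k S P"
  unfolding spine_def using assms by simp

lemma spineD:
  assumes "spine adj X k S P"
  shows "S \<subseteq> X" "pathdec adj S P" "B \<in> set P \<Longrightarrow> card B \<le> k"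
    and "conn adj D \<Longrightarrow> D \<subseteq> X - S \<Longrightarrow> \<exists>B\<in>set P. \<forall>x\<in>D. \<forall>y\<in>S. adj x y \<longrightarrow> y \<in> B"
  using assms unfolding spine_def by simp_all

text \<open>Each step of the chain puts one bag in front: the two boundaries and the new vertices of
  \<open>R\<close>. This bag meets the old set \<open>X\<close> only in the boundary of
  \<open>X\<close>; the induction keeps that boundary inside the first bag, so no interval is
  torn.\<close>

lemma good_spine:
  assumes "good adj V R k X" "symp adj" "finite V"
  shows "\<exists>S P. spine adj X (3 * k) S P \<and> R \<inter> X \<subseteq> S \<and> P \<noteq> [] \<and> boundary adj V X \<subseteq> hd P"
  using assms(1)
proof (induction rule: good.induct)
  case empty
  have "spine adj {} (3 * k) {} [{}]"
    by (rule spineI) (auto intro!: pathdecI)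
  then show ?case by (intro exI[of _ "{}"] exI[of _ "[{}]"]) (auto simp: bd_def)
next
  case (step X Y)
  let ?b = "boundary adj V"
  obtain S P where S: "spine adj X (3 * k) S P" "R \<inter> X \<subseteq> S" "P \<noteq> []" "?b X \<subseteq> hd P"
    using step.IH by blast
  note SX = spineD(1)[OF S(1)] and PP = spineD(2)[OF S(1)]
  let ?N = "R \<inter> (Y - X)"
  let ?B = "?b X \<union> ?b Y \<union> ?N"
  have hS: "hd P \<subseteq> S" using pathdecD(1)[OF PP] S(3) by simp
  have bX: "?b X \<subseteq> X" "?b Y \<subseteq> Y" by (rule bd_subset)+
  have bYX: "?b Y \<inter> X \<subseteq> ?b X" using step.hyps(2) unfolding bd_def by blast
  have BX: "?B \<inter> X \<subseteq> hd P" using bYX S(4) by blast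
  have YV: "Y \<subseteq> V" using step.hyps(3) .
  have cross: "x \<in> ?b X" if "x \<in> X" "y \<in> Y - X" "adj x y" for x y
    using that YV unfolding bd_def by blast
  have S'X: "(S \<union> ?B) \<inter> X = S" using BX hS SX by blast
  have new: "x \<in> ?B" if "x \<in> S \<union> ?B" "x \<notin> X" for x using that SX by blast
  have pd: "pathdec adj (S \<union> ?B) (?B # P)"
  proof (rule pathdecI)
    fix B assume "B \<in> set (?B # P)"
    then show "B \<subseteq> S \<union> ?B" using pathdecD(1)[OF PP, of B] by auto
  next
    fix x y assume xy: "x \<in> S \<union> ?B" "y \<in> S \<union> ?B" "adj x y"
    have yx: "adj y x" using sympD[OF assms(2) xy(3)] .
    have inY: "x \<in> Y" "y \<in> Y" using xy(1,2) SX bX step.hyps(2) by blast+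
    consider "x \<in> X" "y \<in> X" | "x \<in> X" "y \<notin> X" | "x \<notin> X" "y \<in> X" | "x \<notin> X" "y \<notin> X" by blast
    then show "\<exists>B\<in>set (?B # P). x \<in> B \<and> y \<in> B"
    proof cases
      case 1
      then have "x \<in> S" "y \<in> S" using xy(1,2) S'X by blast+
      then show ?thesis using pathdecD(2)[OF PP _ _ xy(3)] by simp
    next
      case 2
      then have "x \<in> ?B" "y \<in> ?B" using cross[of x y] xy(3) new[OF xy(2)] inY by blast+
      then show ?thesis by simp
    next
      case 3
      then have "x \<in> ?B" "y \<in> ?B" using cross[of y x] yx new[OF xy(1)] inY by blast+
      then show ?thesis by simp
    next
      case 4
      then show ?thesis using new[OF xy(1)] new[OF xy(2)] by simp
    qed
  next
    fix v assume v: "v \<in> S \<union> ?B"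
    show "v \<in> \<Union>(set (?B # P))" using v pathdecD(3)[OF PP, of v] by auto
    show "contiguous v (?B # P)"
    proof (cases "v \<in> X")
      case True
      then have "v \<in> S" using v S'X by blast
      then show ?thesis using pathdecD(4)[OF PP] BX True by auto
    next
      case False
      then have "v \<notin> \<Union>(set P)" using pathdecD(1)[OF PP] SX by blast
      then show ?thesis by (simp add: contiguous_notin)
    qed
  qed
  have cX: "card (?b X) \<le> k"
    using step.hyps(1) by (cases rule: good.cases) (auto simp: bd_def)
  have cB: "card ?B \<le> 3 * k"
  proof -
    have "card ?B \<le> card (?b X \<union> ?b Y) + card ?N" by (rule card_Un_le)
    also have "card (?b X \<union> ?b Y) \<le> card (?b X) + card (?b Y)" by (rule card_Un_le)
    finally show ?thesis using cX step.hyps(4,5) by linarith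
  qed
  have "spine adj Y (3 * k) (S \<union> ?B) (?B # P)"
  proof (rule spineI[OF _ pd])
    show "S \<union> ?B \<subseteq> Y" using SX bX step.hyps(2) by blast
    show "card B \<le> 3 * k" if "B \<in> set (?B # P)" for B
      using that cB spineD(3)[OF S(1), of B] by auto
    fix D assume D: "conn adj D" "D \<subseteq> Y - (S \<union> ?B)"
    show "\<exists>B\<in>set (?B # P). \<forall>x\<in>D. \<forall>y\<in>S \<union> ?B. adj x y \<longrightarrow> y \<in> B"
    \<comment> \<open>Edges from \<open>X\<close> to \<open>Y - X\<close> start in
      \<open>?b X\<close>, which \<open>D\<close> avoids. So either \<open>D\<close> lies in
      \<open>X\<close> and the old decomposition handles it, or it lies outside \<open>X\<close> and
      all its neighbours in \<open>S \<union> ?B\<close> are in the new bag.\<close>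
    proof (cases "D \<inter> (X - ?b X) = {}")
      case True
      have inB: "y \<in> ?B" if "x \<in> D" "y \<in> S \<union> ?B" "adj x y" for x y
      proof (cases "y \<in> X")
        case True
        have "x \<in> Y - X" using that(1) D(2) \<open>D \<inter> (X - ?b X) = {}\<close> by blast
        then show ?thesis using cross[OF True] sympD[OF assms(2) that(3)] by blast
      next
        case False
        then show ?thesis using new[OF that(2)] by simp
      qed
      show ?thesis by (intro bexI[of _ ?B] ballI impI, rule inB) simp_all
    next
      case False
      have "D \<subseteq> X - ?b X"
      proof (rule conn_separated[OF D(1), of _ "Y - X"])
        show "D \<subseteq> (X - ?b X) \<union> (Y - X)" using D(2) by blast
        show "\<not> adj x y" if "x \<in> X - ?b X" "y \<in> Y - X - (X - ?b X)" for x y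
          using cross[of x y] that by blast
      qed (rule False)
      then have DX: "D \<subseteq> X - S" using D(2) by blast
      obtain B where B: "B \<in> set P" "\<forall>x\<in>D. \<forall>y\<in>S. adj x y \<longrightarrow> y \<in> B"
        using spineD(4)[OF S(1) D(1) DX] by blast
      have inB: "y \<in> B" if "x \<in> D" "y \<in> S \<union> ?B" "adj x y" for x y
      proof -
        have "x \<in> X" "x \<notin> ?b X" using \<open>D \<subseteq> X - ?b X\<close> that(1) by blast+
        moreover have "y \<in> Y" using that(2) SX bX step.hyps(2) by blast
        ultimately have "y \<in> X" using cross[of x y] that(3) by blast
        then have "y \<in> S" using that(2) S'X by blast
        then show ?thesis using B(2) that(1,3) by simp
      qed
      show ?thesis by (intro bexI[of _ B] ballI impI, rule inB) (simp_all add: B(1))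
    qed
  qed
  moreover have "R \<inter> Y \<subseteq> S \<union> ?B"
  proof
    fix r assume "r \<in> R \<inter> Y"
    then show "r \<in> S \<union> ?B" using S(2) by (cases "r \<in> X") auto
  qed
  moreover have "?b Y \<subseteq> hd (?B # P)" by auto
  ultimately show ?case by (intro exI[of _ "S \<union> ?B"] exI[of _ "?B # P"] conjI) simp_all
qed

text \<open>Components are inserted one at a time. There are no edges between them, so each attaches
  to a bag of the original \<open>P\<close>, which survives all earlier insertions.\<close>

lemma assemble:
  fixes adj :: "'a \<Rightarrow> 'a \<Rightarrow> bool"
  assumes "symp adj" "pathdec adj S P" "\<And>B i. B \<in> set P \<Longrightarrow> card {v \<in> B. L v = i} \<le> K"
    and "finite \<D>" "\<And>D. D \<in> \<D> \<Longrightarrow> component adj (C - S) D"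
    and "\<And>D. D \<in> \<D> \<Longrightarrow> \<exists>B\<in>set P. (\<forall>x\<in>D. \<forall>y\<in>S. adj x y \<longrightarrow> y \<in> B) \<and>
      (\<exists>Q. pathdec adj D Q \<and> (\<forall>W\<in>set Q. \<forall>i. card {v \<in> B \<union> W. L v = i} \<le> K))"
  shows "\<exists>P'. pathdec adj (S \<union> \<Union>\<D>) P' \<and> set P \<subseteq> set P' \<and> (\<forall>B\<in>set P'. \<forall>i. card {v \<in> B. L v = i} \<le> K)"
  using assms(4-6)
proof (induction \<D> rule: finite_induct)
  case empty
  then show ?case using assms(2,3) by auto
next
  case (insert D \<D>)
  have "\<exists>P'. pathdec adj (S \<union> \<Union>\<D>) P' \<and> set P \<subseteq> set P' \<and> (\<forall>B\<in>set P'. \<forall>i. card {v \<in> B. L v = i} \<le> K)"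
    by (rule insert.IH) (use insert.prems in simp_all)
  then obtain P' where P': "pathdec adj (S \<union> \<Union>\<D>) P'" "set P \<subseteq> set P'"
    "\<And>B i. B \<in> set P' \<Longrightarrow> card {v \<in> B. L v = i} \<le> K" by blast
  obtain B Q where B: "B \<in> set P" "\<And>x y. x \<in> D \<Longrightarrow> y \<in> S \<Longrightarrow> adj x y \<Longrightarrow> y \<in> B"
    and Q: "pathdec adj D Q" "\<And>W i. W \<in> set Q \<Longrightarrow> card {v \<in> B \<union> W. L v = i} \<le> K"
    using insert.prems(2)[of D] by blast
  have cD: "component adj (C - S) D" using insert.prems(1) by simp
  have disj: "D \<inter> D' = {}" "D' \<subseteq> C - S" if "D' \<in> \<D>" for D'
  proof -
    have "component adj (C - S) D'" "D \<noteq> D'" using insert.prems(1) insert.hyps(2) that by auto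
    then show "D \<inter> D' = {}" "D' \<subseteq> C - S" using component_disjoint[OF cD] unfolding component_def by auto
  qed
  have "D \<inter> (S \<union> \<Union>\<D>) = {}" using disj cD unfolding component_def by blast
  moreover have "y \<in> B" if "x \<in> D" "y \<in> S \<union> \<Union>\<D>" "adj x y" for x y
  proof (cases "y \<in> S")
    case True
    then show ?thesis using B(2) that by blast
  next
    case False
    then have "y \<in> (C - S) - D" using that(2) disj by blast
    then show ?thesis using cD that(1,3) unfolding component_def by blast
  qed
  ultimately obtain P'' where P'': "pathdec adj (S \<union> \<Union>\<D> \<union> D) P''"
      "set P'' = set P' \<union> (\<lambda>W. B \<union> W) ` set Q"
    using pathdec_insert[OF P'(1) Q(1) assms(1), of B] B(1) P'(2) by blast
  have "card {v \<in> B'. L v = i} \<le> K" if "B' \<in> set P''" for B' i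
    using that P'(3) Q(2) unfolding P''(2) by auto
  moreover have "S \<union> \<Union>(insert D \<D>) = S \<union> \<Union>\<D> \<union> D" by auto
  ultimately show ?case using P'' P'(2) by (intro exI[of _ P'']) auto
qed

subsection \<open>The layered decomposition\<close>

definition layered_pathdec :: "('a \<Rightarrow> 'a \<Rightarrow> bool) \<Rightarrow> 'a set \<Rightarrow> nat \<Rightarrow> 'a set list \<Rightarrow> ('a \<Rightarrow> nat) \<Rightarrow> bool" where
  "layered_pathdec adj C k P L \<longleftrightarrow> pathdec adj C P \<and>
    (\<forall>x\<in>C. \<forall>y\<in>C. adj x y \<longrightarrow> L x \<le> Suc (L y)) \<and>
    (\<forall>B\<in>set P. \<forall>i. card {v \<in> B. L v = i} \<le> k)"

lemma layered_pathdecI: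
  assumes "pathdec adj C P" "\<And>x y. x \<in> C \<Longrightarrow> y \<in> C \<Longrightarrow> adj x y \<Longrightarrow> L x \<le> Suc (L y)"
    and "\<And>B i. B \<in> set P \<Longrightarrow> card {v \<in> B. L v = i} \<le> k"
  shows "layered_pathdec adj C k P L"
  unfolding layered_pathdec_def using assms by simp

lemma layered_pathdecD:
  assumes "layered_pathdec adj C k P L"
  shows "pathdec adj C P" "x \<in> C \<Longrightarrow> y \<in> C \<Longrightarrow> adj x y \<Longrightarrow> L x \<le> Suc (L y)"
    and "B \<in> set P \<Longrightarrow> card {v \<in> B. L v = i} \<le> k"
  using assms unfolding layered_pathdec_def by simp_all

text \<open>The recursion keeps these vertices in layer 0; after a shift by one, edges from
  \<open>C\<close> back to the previous spine then join consecutive layers.\<close>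

definition attached :: "('a \<Rightarrow> 'a \<Rightarrow> bool) \<Rightarrow> 'a set \<Rightarrow> 'a set \<Rightarrow> 'a set" where
  "attached adj Q C = {x \<in> C. \<exists>q\<in>Q. adj x q}"

text \<open>If a part \<open>K\<close> is separated from the hub \<open>Q\<close> by \<open>D\<close>, then \<open>K\<close> can be merged into the
  component \<open>D\<close>, which yields the smaller spine \<open>S - K\<close>.\<close>

lemma minimal_spine_connected:
  fixes adj :: "'a \<Rightarrow> 'a \<Rightarrow> bool"
  assumes "symp adj" "finite C" and Q: "conn adj Q" "Q \<inter> C = {}" "conn adj (Q \<union> C)"
    and S: "spine adj C k S P" "\<And>x q. x \<in> C \<Longrightarrow> q \<in> Q \<Longrightarrow> adj x q \<Longrightarrow> x \<in> S"
    and min: "\<And>S' P'. spine adj C k S' P' \<Longrightarrow> (\<And>x q. x \<in> C \<Longrightarrow> q \<in> Q \<Longrightarrow> adj x q \<Longrightarrow> x \<in> S') \<Longrightarrow>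
      card S \<le> card S'"
    and D: "component adj (C - S) D"
  shows "conn adj (Q \<union> (C - D))"
proof -
  have cD: "conn adj D" "D \<subseteq> C - S" "\<And>x y. x \<in> D \<Longrightarrow> y \<in> C - S \<Longrightarrow> y \<notin> D \<Longrightarrow> \<not> adj x y"
    using D unfolding component_def by auto
  note SC = spineD(1)[OF S(1)] and PP = spineD(2)[OF S(1)]
  have sym: "adj y x" if "adj x y" for x y using sympD[OF assms(1) that] .
  obtain Z where Z: "component adj (Q \<union> (C - D)) Z" "Q \<subseteq> Z"
    using component_exists[OF assms(1) Q(1), of "Q \<union> (C - D)"] by blast
  have cZ: "conn adj Z" "Z \<subseteq> Q \<union> (C - D)" "\<And>x y. x \<in> Z \<Longrightarrow> y \<in> Q \<union> (C - D) \<Longrightarrow> y \<notin> Z \<Longrightarrow> \<not> adj x y"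
    using Z(1) unfolding component_def by auto
  define K where "K = (C - D) - Z"
  have KC: "K \<subseteq> C" "K \<inter> D = {}" "K \<inter> Z = {}" unfolding K_def by auto
  have KZ: "\<not> adj x y" if "x \<in> K" "y \<in> Z" for x y
  proof -
    have "x \<in> Q \<union> (C - D)" "x \<notin> Z" using that(1) unfolding K_def by auto
    then show ?thesis using cZ(3)[of y x] that(2) sym by blast
  qed
  have inZ: "y \<in> Z" if "y \<in> C" "y \<notin> D" "y \<notin> K" for y
    using that unfolding K_def by auto
  have "K = {}"
  proof (rule ccontr)
    assume "K \<noteq> {}"
    have "spine adj C k (S - K) (map (\<lambda>B. B - K) P)"
    proof (rule spineI[OF _ pathdec_Diff[OF PP]])
      show "S - K \<subseteq> C" using SC by blast
    next
      fix B assume "B \<in> set (map (\<lambda>B. B - K) P)"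
      then obtain B' where B': "B' \<in> set P" "B = B' - K" by auto
      have "finite B'" using pathdecD(1)[OF PP B'(1)] SC assms(2) by (meson finite_subset)
      then have "card B \<le> card B'" unfolding B'(2) by (intro card_mono) auto
      then show "card B \<le> k" using spineD(3)[OF S(1) B'(1)] by linarith
    next
      fix D' assume D': "conn adj D'" "D' \<subseteq> C - (S - K)"
      show "\<exists>B\<in>set (map (\<lambda>B. B - K) P). \<forall>x\<in>D'. \<forall>y\<in>S - K. adj x y \<longrightarrow> y \<in> B"
      proof (cases "D' \<inter> (K \<union> D) = {}")
        case True
        then have "D' \<subseteq> C - S" using D'(2) by blast
        then obtain B where B: "B \<in> set P" "\<And>x y. x \<in> D' \<Longrightarrow> y \<in> S \<Longrightarrow> adj x y \<Longrightarrow> y \<in> B"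
          using spineD(4)[OF S(1) D'(1)] by meson
        have "y \<in> B - K" if "x \<in> D'" "y \<in> S - K" "adj x y" for x y using B(2)[of x y] that by simp
        moreover have "B - K \<in> set (map (\<lambda>B. B - K) P)" using B(1) by simp
        ultimately show ?thesis by meson
      next
        case False
        \<comment> \<open>A connected set that avoids \<open>S - K\<close> and meets
          \<open>K \<union> D\<close> cannot leave \<open>K \<union> D\<close>. As \<open>K\<close>
          has no neighbours in \<open>S - K\<close>, the bag that serves \<open>D\<close> also
          serves \<open>D'\<close>.\<close>
        have sub: "D' \<subseteq> K \<union> D"
        proof (rule conn_separated[OF D'(1) _ False])
          show "D' \<subseteq> K \<union> D \<union> (C - (S - K))" using D'(2) by blast
          fix x y assume x: "x \<in> K \<union> D" and y: "y \<in> C - (S - K) - (K \<union> D)"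
          have "y \<in> C - S" "y \<notin> D" "y \<in> Z" using y inZ[of y] by auto
          then show "\<not> adj x y" using x KZ[of x y] cD(3)[of x y] by blast
        qed
        obtain B where B: "B \<in> set P" "\<And>x y. x \<in> D \<Longrightarrow> y \<in> S \<Longrightarrow> adj x y \<Longrightarrow> y \<in> B"
          using spineD(4)[OF S(1) cD(1,2)] by meson
        have "y \<in> B - K" if xy: "x \<in> D'" "y \<in> S - K" "adj x y" for x y
        proof (cases "x \<in> D")
          case True
          then show ?thesis using B(2)[of x y] xy by simp
        next
          case False
          then have "x \<in> K" using sub xy(1) by blast
          moreover have "y \<in> Z" using xy(2) inZ[of y] SC cD(2) by blast
          ultimately show ?thesis using KZ xy(3) by blast
        qed
        moreover have "B - K \<in> set (map (\<lambda>B. B - K) P)" using B(1) by simp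
        ultimately show ?thesis by meson
      qed
    qed
    moreover have "x \<in> S - K" if "x \<in> C" "q \<in> Q" "adj x q" for x q
      using S(2)[OF that] KZ[of x q] that Z(2) by blast
    ultimately have le: "card S \<le> card (S - K)" by (rule min)
    \<comment> \<open>By connectedness of \<open>Q \<union> C\<close> some edge leaves
      \<open>K\<close>, necessarily into \<open>D\<close>. Its end in \<open>K\<close> belongs to
      \<open>S\<close>, for otherwise it would be in \<open>D\<close>; so removing \<open>K\<close>
      really shrinks the spine.\<close>
    have "K \<subseteq> Q \<union> C" "K \<noteq> Q \<union> C" using KC Q(2) conn_nonempty[OF Q(1)] by auto
    then obtain x y where xy: "x \<in> K" "y \<in> Q \<union> C" "y \<notin> K" "adj x y"
      using connD[OF Q(3) _ \<open>K \<noteq> {}\<close>] by metis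
    have "y \<notin> Z" using KZ[OF xy(1)] xy(4) by blast
    then have "y \<in> D" using inZ[of y] xy(2,3) Z(2) by blast
    then have "x \<in> S" using cD(3)[of y x] xy(1) KC sym[OF xy(4)] by blast
    then have "S - K \<subset> S" using xy(1) by blast
    moreover have "finite S" using SC assms(2) by (rule finite_subset)
    ultimately have "card (S - K) < card S" by (intro psubset_card_mono)
    then show False using le by linarith
  qed
  then have "Z = Q \<union> (C - D)" using cZ(2) Z(2) unfolding K_def by blast
  then show ?thesis using cZ(1) by simp
qed

text \<open>The spine of \<open>C\<close> forms layer 0. A component \<open>D\<close> of the rest is treated recursively
  with the hub \<open>Q \<union> (C - D)\<close>; its bags are inserted, united with the bag \<open>D\<close> attaches to, right
  after that bag.\<close>

lemma layered_decomposition: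
  fixes adj :: "'a \<Rightarrow> 'a \<Rightarrow> bool" and f :: "'b \<Rightarrow> 'b \<Rightarrow> bool"
  assumes "symp adj" "symp f" "degenerate f W"
    and nomodel: "\<And>Q \<mu>. conn adj Q \<Longrightarrow> Q \<subseteq> V \<Longrightarrow> model adj f W \<mu> \<Longrightarrow>
      (\<And>u. u \<in> W \<Longrightarrow> \<mu> u \<subseteq> V - Q \<and> (\<exists>x\<in>\<mu> u. \<exists>q\<in>Q. adj x q)) \<Longrightarrow> False"
    and "finite C" "conn adj Q" "Q \<inter> C = {}" "conn adj (Q \<union> C)" "Q \<union> C \<subseteq> V"
  shows "\<exists>P L. layered_pathdec adj C (3 * card W) P L \<and> L ` attached adj Q C \<subseteq> {0}"
  using assms(5-9)
proof (induction "card C" arbitrary: C Q rule: less_induct)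
  case less
  note fC = less.prems(1) and Q = less.prems(2-5)
  let ?k = "card W"
  show ?case
  proof (cases "C = {}")
    case True
    then show ?thesis by (intro exI[of _ "[]"] exI[of _ "\<lambda>_. 0"]) (simp add: layered_pathdec_def pathdec_def attached_def)
  next
    case False
    define R where "R = {x \<in> C. \<exists>q\<in>Q. adj x q}"
    have sym: "adj y x" if "adj x y" for x y using sympD[OF assms(1) that] .
    have "good adj C R ?k C"
    proof (rule ccontr)
      assume "\<not> good adj C R ?k C"
      then obtain \<mu> where \<mu>: "model adj f W \<mu>" "\<And>u. u \<in> W \<Longrightarrow> \<mu> u \<subseteq> C" "\<And>u. u \<in> W \<Longrightarrow> \<mu> u \<inter> R \<noteq> {}"
        using rooted_model_or_good[OF assms(3) fC assms(1,2), of R] unfolding R_def by auto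
      have "\<mu> u \<subseteq> V - Q \<and> (\<exists>x\<in>\<mu> u. \<exists>q\<in>Q. adj x q)" if "u \<in> W" for u
        using \<mu>(2,3)[OF that] Q(2,4) unfolding R_def by blast
      then show False using nomodel[OF Q(1) _ \<mu>(1)] Q(4) by simp
    qed
    then obtain S0 P0 where "spine adj C (3 * ?k) S0 P0" "R \<inter> C \<subseteq> S0"
      using good_spine[OF _ assms(1) fC, of R ?k C] by blast
    then have "\<exists>P. spine adj C (3 * ?k) S0 P \<and> R \<subseteq> S0" unfolding R_def by blast
    then obtain S where ex: "\<exists>P. spine adj C (3 * ?k) S P \<and> R \<subseteq> S"
      and min: "\<And>S'. \<exists>P. spine adj C (3 * ?k) S' P \<and> R \<subseteq> S' \<Longrightarrow> card S \<le> card S'"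
      using ex_has_least_nat[of "\<lambda>S. \<exists>P. spine adj C (3 * ?k) S P \<and> R \<subseteq> S" S0 card] by blast
    obtain P where S: "spine adj C (3 * ?k) S P" "R \<subseteq> S" using ex by blast
    note SC = spineD(1)[OF S(1)] and PP = spineD(2)[OF S(1)]
    have inS: "x \<in> S" if "x \<in> C" "q \<in> Q" "adj x q" for x q
      using that S(2) unfolding R_def by blast
    have hub: "conn adj (Q \<union> (C - D))" if "component adj (C - S) D" for D
    proof (rule minimal_spine_connected[OF assms(1) fC Q(1-3) S(1) inS _ that])
      fix S' P' assume a: "spine adj C (3 * ?k) S' P'" "\<And>x q. x \<in> C \<Longrightarrow> q \<in> Q \<Longrightarrow> adj x q \<Longrightarrow> x \<in> S'"
      have "R \<subseteq> S'" using a(2) unfolding R_def by blast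
      then show "card S \<le> card S'" using min[of S'] a(1) by blast
    qed
    \<comment> \<open>Ensures that the recursion terminates: some vertex of \<open>C\<close> is next
      to the hub, so every component of \<open>C - S\<close> is smaller than
      \<open>C\<close>.\<close>
    have "S \<noteq> {}"
    proof -
      have "Q \<noteq> Q \<union> C" using False Q(2) by blast
      then obtain x y where "x \<in> Q" "y \<in> Q \<union> C" "y \<notin> Q" "adj x y"
        using connD[OF Q(3) _ conn_nonempty[OF Q(1)]] by (metis Un_upper1)
      then have "y \<in> S" using inS[of y x] sym by blast
      then show ?thesis by blast
    qed
    let ?\<D> = "{D. component adj (C - S) D}"
    have sub: "D \<subseteq> C - S" if "D \<in> ?\<D>" for D using that unfolding component_def by simp
    have "\<exists>P L. layered_pathdec adj D (3 * ?k) P L \<and> L ` attached adj (Q \<union> (C - D)) D \<subseteq> {0}"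
      if D: "D \<in> ?\<D>" for D
    proof (rule less.hyps)
      have "D \<subset> C" using sub[OF D] SC \<open>S \<noteq> {}\<close> by blast
      then show "card D < card C" using fC by (intro psubset_card_mono)
      show "finite D" using \<open>D \<subset> C\<close> fC by (meson finite_subset psubset_imp_subset)
      show "conn adj (Q \<union> (C - D))" using hub D by simp
      show "(Q \<union> (C - D)) \<inter> D = {}" using Q(2) \<open>D \<subset> C\<close> by blast
      have "Q \<union> (C - D) \<union> D = Q \<union> C" using \<open>D \<subset> C\<close> by blast
      then show "conn adj (Q \<union> (C - D) \<union> D)" "Q \<union> (C - D) \<union> D \<subseteq> V" using Q(3,4) by simp_all
    qed
    then obtain PD LD where D_dec: "\<And>D. D \<in> ?\<D> \<Longrightarrow> layered_pathdec adj D (3 * ?k) (PD D) (LD D)"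
      and D_zero: "\<And>D. D \<in> ?\<D> \<Longrightarrow> LD D ` attached adj (Q \<union> (C - D)) D \<subseteq> {0}"
      by metis
    note PD = layered_pathdecD(1)[OF D_dec] and LD = layered_pathdecD(2)[OF D_dec]
      and wD = layered_pathdecD(3)[OF D_dec]
    have LD0: "LD D x = 0" if "D \<in> ?\<D>" "x \<in> D" "q \<in> Q \<union> (C - D)" "adj x q" for D x q
      using D_zero[OF that(1)] that(2-4) unfolding attached_def by blast
    define L where "L x = (if x \<in> S then 0 else Suc (LD (SOME D. D \<in> ?\<D> \<and> x \<in> D) x))" for x
    have LS: "L x = 0" if "x \<in> S" for x using that unfolding L_def by simp
    have LL: "L x = Suc (LD D x)" if D: "D \<in> ?\<D>" and x: "x \<in> D" for D x
    proof -
      have "x \<notin> S" using sub[OF D] x by blast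
      have "(SOME D. D \<in> ?\<D> \<and> x \<in> D) = D"
      proof (rule some_equality)
        fix D' assume "D' \<in> ?\<D> \<and> x \<in> D'"
        then show "D' = D" using component_disjoint[of adj "C - S" D D'] D x by auto
      qed (use D x in simp)
      then show ?thesis using \<open>x \<notin> S\<close> unfolding L_def by simp
    qed
    have cover: "\<exists>D\<in>?\<D>. x \<in> D" if "x \<in> C" "x \<notin> S" for x
      using component_exists[OF assms(1) conn_singleton[of adj x], of "C - S"] that by blast
    have finbag: "finite B" if "B \<in> set P" for B
      using pathdecD(1)[OF PP that] SC fC by (meson finite_subset)
    have wP: "card {v \<in> B. L v = i} \<le> 3 * ?k" if B: "B \<in> set P" for B i
    proof -
      have "card {v \<in> B. L v = i} \<le> card B" using finbag[OF B] by (intro card_mono) auto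
      then show ?thesis using spineD(3)[OF S(1) B] by linarith
    qed
    have attach: "\<exists>B\<in>set P. (\<forall>x\<in>D. \<forall>y\<in>S. adj x y \<longrightarrow> y \<in> B) \<and>
      (\<exists>Q. pathdec adj D Q \<and> (\<forall>W\<in>set Q. \<forall>i. card {v \<in> B \<union> W. L v = i} \<le> 3 * ?k))" if D: "D \<in> ?\<D>" for D
    proof -
      have "conn adj D" using D unfolding component_def by simp
      then obtain B where B: "B \<in> set P" "\<forall>x\<in>D. \<forall>y\<in>S. adj x y \<longrightarrow> y \<in> B"
        using spineD(4)[OF S(1) _ sub[OF D]] by blast
      have BS: "B \<subseteq> S" using pathdecD(1)[OF PP B(1)] .
      \<comment> \<open>Layer 0 comes only from \<open>B\<close> and each later layer only from
        \<open>U\<close>, so the widths of the united bags do not add up.\<close>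
      have "card {v \<in> B \<union> U. L v = i} \<le> 3 * ?k" if U: "U \<in> set (PD D)" for U i
      proof -
        have UD: "U \<subseteq> D" using pathdecD(1)[OF PD[OF D] U] .
        show ?thesis
        proof (cases i)
          case 0
          have "{v \<in> B \<union> U. L v = i} = {v \<in> B. L v = i}" using LL[OF D] UD 0 by fastforce
          then show ?thesis using wP[OF B(1)] by simp
        next
          case (Suc j)
          have "{v \<in> B \<union> U. L v = i} = {v \<in> U. LD D v = j}"
            using LL[OF D] LS UD BS Suc by force
          then show ?thesis using wD[OF D U, of j] by simp
        qed
      qed
      then show ?thesis using B PD[OF D] by (intro bexI[OF _ B(1)] conjI exI[of _ "PD D"]) simp_all
    qed
    have "\<exists>P'. pathdec adj (S \<union> \<Union>?\<D>) P' \<and> set P \<subseteq> set P' \<and>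
      (\<forall>B\<in>set P'. \<forall>i. card {v \<in> B. L v = i} \<le> 3 * ?k)"
    proof (rule assemble[where C = C, OF assms(1) PP wP])
      show "finite ?\<D>" by (rule finite_subset[of _ "Pow C"]) (use sub fC in auto)
    qed (assumption, simp, erule attach)
    then obtain P' where P': "pathdec adj (S \<union> \<Union>?\<D>) P'" "\<forall>B\<in>set P'. \<forall>i. card {v \<in> B. L v = i} \<le> 3 * ?k"
      by blast
    have "S \<union> \<Union>?\<D> = C" using cover sub SC by blast
    moreover have "L x \<le> Suc (L y)" if xy: "x \<in> C" "y \<in> C" "adj x y" for x y
    proof (cases "x \<in> S")
      case True
      then show ?thesis using LS by simp
    next
      case False
      then obtain D where D: "D \<in> ?\<D>" "x \<in> D" using cover[OF xy(1)] by blast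
      show ?thesis
      proof (cases "y \<in> D")
        case True
        then show ?thesis using LL[OF D(1)] LD[OF D True xy(3)] D(2) by simp
      next
        case False
        \<comment> \<open>The edge leaves \<open>D\<close>, so \<open>x\<close> is attached to the
          hub of \<open>D\<close> and gets layer 1, which is within the bound for any layer of
          \<open>y\<close>.\<close>
        then have "LD D x = 0" using LD0[OF D _ xy(3)] xy(2) by blast
        then show ?thesis using LL[OF D] by simp
      qed
    qed
    ultimately have "layered_pathdec adj C (3 * ?k) P' L"
      using P' by (intro layered_pathdecI) simp_all
    moreover have "L ` attached adj Q C \<subseteq> {0}"
      using inS LS unfolding attached_def by auto
    ultimately show ?thesis by blast
  qed
qed

text \<open>The recursion needs a hub to start with: in each component of \<open>V\<close>, an
  arbitrary vertex \<open>c\<close> is the hub and forms layer 0 on its own. The \<open>+ 1\<close>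
  covers this layer even if \<open>W\<close> is empty.\<close>

lemma layered_pathdec_exists:
  fixes adj :: "'a \<Rightarrow> 'a \<Rightarrow> bool" and f :: "'b \<Rightarrow> 'b \<Rightarrow> bool"
  assumes "symp adj" "symp f" "degenerate f W" "finite V"
    and nomodel: "\<And>Q \<mu>. conn adj Q \<Longrightarrow> Q \<subseteq> V \<Longrightarrow> model adj f W \<mu> \<Longrightarrow>
      (\<And>u. u \<in> W \<Longrightarrow> \<mu> u \<subseteq> V - Q \<and> (\<exists>x\<in>\<mu> u. \<exists>q\<in>Q. adj x q)) \<Longrightarrow> False"
  shows "\<exists>P L. layered_pathdec adj V (3 * card W + 1) P L"
proof -
  let ?k = "3 * card W + 1"
  let ?\<D> = "{D. component adj V D}"
  have sub: "D \<subseteq> V" if "D \<in> ?\<D>" for D using that unfolding component_def by simp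
  have "\<exists>P L. layered_pathdec adj D ?k P L" if D: "D \<in> ?\<D>" for D
  proof -
    have cD: "conn adj D" using D unfolding component_def by simp
    then obtain c where c: "c \<in> D" using conn_nonempty by blast
    have fD: "finite D" using sub[OF D] assms(4) by (rule finite_subset)
    have e: "{c} \<union> (D - {c}) = D" using c by blast
    have "\<exists>P L. layered_pathdec adj (D - {c}) (3 * card W) P L \<and> L ` attached adj {c} (D - {c}) \<subseteq> {0}"
    proof (rule layered_decomposition[OF assms(1-3)])
      fix Q \<mu>
      assume "conn adj Q" "Q \<subseteq> V" "model adj f W \<mu>"
        "\<And>u. u \<in> W \<Longrightarrow> \<mu> u \<subseteq> V - Q \<and> (\<exists>x\<in>\<mu> u. \<exists>q\<in>Q. adj x q)"
      then show False by (rule nomodel)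
    qed (use cD fD sub[OF D] e conn_singleton[of adj c] in auto)
    then obtain P L where dec: "layered_pathdec adj (D - {c}) (3 * card W) P L"
      and zero: "L ` attached adj {c} (D - {c}) \<subseteq> {0}" by blast
    note P = layered_pathdecD(1)[OF dec] and L = layered_pathdecD(2)[OF dec]
      and w = layered_pathdecD(3)[OF dec]
    have L0: "L x = 0" if "x \<in> D - {c}" "adj x c" for x
      using zero that unfolding attached_def by blast
    have single: "pathdec adj {c} [{c}]" by (rule pathdecI) auto
    obtain P' where P': "pathdec adj D P'" "set P' = {{c}} \<union> (\<lambda>B. {c} \<union> B) ` set P"
      using pathdec_insert[OF single P assms(1), of "{c}"] e by auto
    define L' where "L' x = (if x = c then 0 else Suc (L x))" for x
    have "L' x \<le> Suc (L' y)" if xy: "x \<in> D" "y \<in> D" "adj x y" for x y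
    proof (cases "x = c \<or> y = c")
      case True
      then show ?thesis using L0[of x] xy unfolding L'_def by auto
    next
      case False
      then show ?thesis using L[of x y] xy unfolding L'_def by simp
    qed
    moreover have "card {v \<in> B. L' v = i} \<le> ?k" if B: "B \<in> set P'" for B i
    proof (cases "B = {c}")
      case True
      have "card {v \<in> B. L' v = i} \<le> card {c}" unfolding True by (intro card_mono) auto
      then show ?thesis by simp
    next
      case False
      then obtain U where U: "U \<in> set P" "B = insert c U" using B P'(2) by auto
      have UD: "U \<subseteq> D - {c}" using pathdecD(1)[OF P U(1)] .
      show ?thesis
      proof (cases i)
        case 0
        have "{v \<in> B. L' v = i} \<subseteq> {c}" using U(2) 0 unfolding L'_def by auto
        then have "card {v \<in> B. L' v = i} \<le> card {c}" by (intro card_mono) auto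
        then show ?thesis by simp
      next
        case (Suc j)
        have "{v \<in> B. L' v = i} = {v \<in> U. L v = j}" using U(2) UD Suc unfolding L'_def by auto
        then show ?thesis using w[OF U(1), of j] by simp
      qed
    qed
    ultimately have "layered_pathdec adj D ?k P' L'"
      using P'(1) by (intro layered_pathdecI)
    then show ?thesis by blast
  qed
  then obtain PD LD where D_dec: "\<And>D. D \<in> ?\<D> \<Longrightarrow> layered_pathdec adj D ?k (PD D) (LD D)"
    by metis
  note PD = layered_pathdecD(1)[OF D_dec] and LD = layered_pathdecD(2)[OF D_dec]
    and wD = layered_pathdecD(3)[OF D_dec]
  define L where "L x = LD (SOME D. D \<in> ?\<D> \<and> x \<in> D) x" for x
  have LL: "L x = LD D x" if D: "D \<in> ?\<D>" and x: "x \<in> D" for D x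
  proof -
    have "(SOME D. D \<in> ?\<D> \<and> x \<in> D) = D"
    proof (rule some_equality)
      fix D' assume "D' \<in> ?\<D> \<and> x \<in> D'"
      then show "D' = D" using component_disjoint[of adj V D D'] D x by auto
    qed (use D x in simp)
    then show ?thesis unfolding L_def by simp
  qed
  have cover: "\<exists>D\<in>?\<D>. x \<in> D" if "x \<in> V" for x
    using component_exists[OF assms(1) conn_singleton[of adj x], of V] that by blast
  \<comment> \<open>The components are put side by side by \<open>assemble\<close>, with an empty
    spine that has one empty bag to attach to.\<close>
  have attach: "\<exists>B\<in>set [{}]. (\<forall>x\<in>D. \<forall>y\<in>{}. adj x y \<longrightarrow> y \<in> B) \<and>
    (\<exists>Q. pathdec adj D Q \<and> (\<forall>W\<in>set Q. \<forall>i. card {v \<in> B \<union> W. L v = i} \<le> ?k))" if D: "D \<in> ?\<D>" for D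
  proof -
    have "card {v \<in> B. L v = i} \<le> ?k" if B: "B \<in> set (PD D)" for B i
    proof -
      have "B \<subseteq> D" using pathdecD(1)[OF PD[OF D] B] .
      then have "{v \<in> B. L v = i} = {v \<in> B. LD D v = i}" using LL[OF D] by auto
      then show ?thesis using wD[OF D B] by simp
    qed
    then show ?thesis using PD[OF D] by auto
  qed
  have empty: "pathdec adj {} [{}]" by (rule pathdecI) auto
  have "\<exists>P. pathdec adj ({} \<union> \<Union>?\<D>) P \<and> set [{}] \<subseteq> set P \<and>
    (\<forall>B\<in>set P. \<forall>i. card {v \<in> B. L v = i} \<le> ?k)"
  proof (rule assemble[where C = V, OF assms(1) empty])
    show "finite ?\<D>" by (rule finite_subset[of _ "Pow V"]) (use sub assms(4) in auto)
  qed (simp, simp, erule attach)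
  then obtain P where P: "pathdec adj ({} \<union> \<Union>?\<D>) P" "\<forall>B\<in>set P. \<forall>i. card {v \<in> B. L v = i} \<le> ?k"
    by blast
  have "{} \<union> \<Union>?\<D> = V" using cover sub by blast
  moreover have "L x \<le> Suc (L y)" if xy: "x \<in> V" "y \<in> V" "adj x y" for x y
  proof -
    obtain D where D: "D \<in> ?\<D>" "x \<in> D" using cover[OF xy(1)] by blast
    then have "y \<in> D" using xy unfolding component_def by blast
    then show ?thesis using LL[OF D(1)] LD[OF D _ xy(3)] D(2) by simp
  qed
  ultimately have "layered_pathdec adj V ?k P L"
    using P by (intro layered_pathdecI) simp_all
  then show ?thesis by blast
qed

subsection \<open>Graphs without an apex-forest minor\<close>

abbreviation joined :: "graph \<Rightarrow> nat \<Rightarrow> nat \<Rightarrow> bool" where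
  "joined G x y \<equiv> {x, y} \<in> edges G"

lemma symp_joined: "symp (joined G)"
  by (rule sympI) (simp add: insert_commute)

lemma joined_verts:
  assumes "simple_graph G" "joined G x y"
  shows "x \<noteq> y" "x \<in> verts G" "y \<in> verts G"
proof -
  from assms obtain u v where "{x, y} = {u, v}" "u \<noteq> v" "u \<in> verts G" "v \<in> verts G"
    unfolding simple_graph_def by meson
  then show "x \<noteq> y" "x \<in> verts G" "y \<in> verts G" by (auto simp: doubleton_eq_iff)
qed

lemma conn_connected_in:
  assumes "conn (joined G) B" "B \<subseteq> verts G"
  shows "connected_in G B"
proof -
  let ?r = "{(a, b). a \<in> B \<and> b \<in> B \<and> {a, b} \<in> edges G}"
  have "(x, y) \<in> ?r\<^sup>*" if "x \<in> B" "y \<in> B" for x y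
  proof (rule ccontr)
    assume "(x, y) \<notin> ?r\<^sup>*"
    let ?S = "{z \<in> B. (x, z) \<in> ?r\<^sup>*}"
    have "?S \<subseteq> B" "?S \<noteq> {}" "?S \<noteq> B" using that \<open>(x, y) \<notin> ?r\<^sup>*\<close> by auto
    then obtain a b where "a \<in> ?S" "b \<in> B" "b \<notin> ?S" "joined G a b"
      using connD[OF assms(1), of ?S] by blast
    then have "(x, a) \<in> ?r\<^sup>*" "(a, b) \<in> ?r" by auto
    then have "(x, b) \<in> ?r\<^sup>*" by (rule rtrancl_into_rtrancl)
    then show False using \<open>b \<in> B\<close> \<open>b \<notin> ?S\<close> by simp
  qed
  then show ?thesis using assms(2) conn_nonempty[OF assms(1)] unfolding connected_in_def by simp
qed

text \<open>All neighbours in \<open>W\<close> of the first vertex of a longest path in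
  \<open>W\<close> lie on the path. If there are two of them, the later one has index at least 2 and
  closes a cycle.\<close>

lemma forest_low_degree:
  assumes "simple_graph G" "forest G" "W \<subseteq> verts G" "W \<noteq> {}"
  shows "\<exists>v\<in>W. \<forall>u\<in>W. \<forall>w\<in>W. joined G v u \<longrightarrow> joined G v w \<longrightarrow> u = w"
proof (rule ccontr)
  assume "\<not> ?thesis"
  then have two: "\<exists>u\<in>W. \<exists>w\<in>W. joined G v u \<and> joined G v w \<and> u \<noteq> w" if "v \<in> W" for v
    using that by blast
  have fW: "finite W" using assms(1,3) unfolding simple_graph_def by (meson finite_subset)
  define path where "path xs \<longleftrightarrow> xs \<noteq> [] \<and> distinct xs \<and> set xs \<subseteq> W \<and>
    (\<forall>i. Suc i < length xs \<longrightarrow> joined G (xs ! i) (xs ! Suc i))" for xs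
  obtain v where "v \<in> W" using assms(4) by blast
  then have "path [v]" unfolding path_def by simp
  moreover have "length xs < Suc (card W)" if "path xs" for xs
    using that card_mono[OF fW] distinct_card unfolding path_def by (metis less_Suc_eq_le)
  ultimately obtain xs where xs: "path xs" and longest: "\<And>ys. path ys \<Longrightarrow> length ys \<le> length xs"
    using ex_has_greatest_nat[of path "[v]" length "Suc (card W)"] by (metis less_imp_le)
  have nonempty: "xs \<noteq> []" using xs unfolding path_def by simp
  then have hW: "hd xs \<in> W" using xs hd_in_set unfolding path_def by blast
  have inside: "u \<in> set xs" if "u \<in> W" "joined G (hd xs) u" for u
  proof (rule ccontr)
    assume u: "u \<notin> set xs"
    have "joined G ((u # xs) ! i) ((u # xs) ! Suc i)" if "Suc i < length (u # xs)" for i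
      using that \<open>joined G (hd xs) u\<close> xs nonempty
      by (cases i) (auto simp: path_def hd_conv_nth insert_commute)
    then have "path (u # xs)" using xs u \<open>u \<in> W\<close> unfolding path_def by simp
    then show False using longest[of "u # xs"] by simp
  qed
  obtain u w where uw: "u \<in> W" "w \<in> W" "joined G (hd xs) u" "joined G (hd xs) w" "u \<noteq> w"
    using two[OF hW] by blast
  obtain i j where ij: "i < length xs" "xs ! i = u" "j < length xs" "xs ! j = w"
    using inside uw by (metis in_set_conv_nth)
  have "i \<noteq> j" using ij uw(5) by blast
  moreover have "i \<noteq> 0" "j \<noteq> 0"
    using ij uw(3,4) nonempty joined_verts(1)[OF assms(1)] by (metis hd_conv_nth)+
  ultimately obtain k where k: "2 \<le> k" "k < length xs" "joined G (hd xs) (xs ! k)"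
    using ij uw(3,4) by (metis One_nat_def Suc_1 Suc_leI le_neq_implies_less neq0_conv)
  let ?c = "take (Suc k) xs"
  have "is_cycle G ?c"
    unfolding is_cycle_def
  proof (intro conjI allI impI)
    show "3 \<le> length ?c" using k by simp
    show "distinct ?c" using xs unfolding path_def by simp
    show "set ?c \<subseteq> verts G" using xs assms(3) set_take_subset[of "Suc k" xs] unfolding path_def by blast
    show "{?c ! i, ?c ! Suc i} \<in> edges G" if "Suc i < length ?c" for i
      using that xs unfolding path_def by simp
    have "last ?c = xs ! k" using k(2) by (simp add: take_Suc_conv_app_nth)
    moreover have "hd ?c = hd xs" by (simp add: hd_take)
    ultimately show "{last ?c, hd ?c} \<in> edges G" using k(3) by (simp add: insert_commute)
  qed
  then show False using assms(2) unfolding forest_def by blast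
qed

lemma forest_degenerate:
  assumes "simple_graph G" "forest G" "W \<subseteq> verts G"
  shows "degenerate (joined G) W"
  using assms(3)
proof (induction "card W" arbitrary: W rule: less_induct)
  case less
  have fW: "finite W" using assms(1) less.prems unfolding simple_graph_def by (meson finite_subset)
  show ?case
  proof (cases "W = {}")
    case True
    then show ?thesis by (simp add: degenerate.empty)
  next
    case False
    then obtain v where v: "v \<in> W" "\<And>u w. u \<in> W \<Longrightarrow> w \<in> W \<Longrightarrow> joined G v u \<Longrightarrow> joined G v w \<Longrightarrow> u = w"
      using forest_low_degree[OF assms(1,2) less.prems] by blast
    have "card (W - {v}) < card W" using v(1) fW by (intro psubset_card_mono) auto
    then have "degenerate (joined G) (W - {v})" using less.prems by (intro less.hyps) auto
    then have "degenerate (joined G) (insert v (W - {v}))"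
      using v(2) by (intro degenerate.insert) auto
    then show ?thesis using v(1) by (simp add: insert_absorb)
  qed
qed

section \<open>From \<open>pathdec\<close> and \<open>layered_pathdec\<close> to
  \<open>lpw\<close>\<close>

lemma path_decompositionD:
  assumes "path_decomposition G P"
  shows "B \<in> set P \<Longrightarrow> B \<subseteq> verts G"
    and "e \<in> edges G \<Longrightarrow> \<exists>B\<in>set P. e \<subseteq> B"
    and "v \<in> verts G \<Longrightarrow> \<exists>i<length P. v \<in> P ! i"
    and "v \<in> verts G \<Longrightarrow> i \<le> j \<Longrightarrow> j \<le> k \<Longrightarrow> k < length P \<Longrightarrow> v \<in> P ! i \<Longrightarrow> v \<in> P ! k \<Longrightarrow> v \<in> P ! j"
proof -
  note a = assms[unfolded path_decomposition_def]
  show "B \<in> set P \<Longrightarrow> B \<subseteq> verts G" using conjunct1[OF a] by blast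
  show "e \<in> edges G \<Longrightarrow> \<exists>B\<in>set P. e \<subseteq> B" using conjunct1[OF conjunct2[OF a]] by blast
  note b = conjunct2[OF conjunct2[OF a], rule_format]
  show "v \<in> verts G \<Longrightarrow> \<exists>i<length P. v \<in> P ! i" using b by blast
  show "v \<in> verts G \<Longrightarrow> i \<le> j \<Longrightarrow> j \<le> k \<Longrightarrow> k < length P \<Longrightarrow> v \<in> P ! i \<Longrightarrow> v \<in> P ! k \<Longrightarrow> v \<in> P ! j"
    using b by metis
qed

lemma lpw_le:
  assumes "path_decomposition G P" "layering G L" "layered_width_le P L l"
  shows "lpw G \<le> l"
  unfolding lpw_def using assms by (intro Least_le exI conjI)

lemma lpw_attained:
  assumes "simple_graph G"
  obtains P L where "path_decomposition G P" "layering G L" "layered_width_le P L (lpw G)"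
proof -
  \<comment> \<open>One bag and one layer show that the set under \<open>LEAST\<close> is not
    empty.\<close>
  have "path_decomposition G [verts G]"
    using assms joined_verts(2,3)[OF assms] unfolding path_decomposition_def simple_graph_def by auto
  moreover have "layering G (\<lambda>_. 0)" unfolding layering_def by simp
  moreover have "layered_width_le [verts G] (\<lambda>_. 0) (card (verts G))"
    using assms unfolding layered_width_le_def simple_graph_def by (auto intro: card_mono)
  ultimately have "\<exists>l P L. path_decomposition G P \<and> layering G L \<and> layered_width_le P L l" by blast
  then have "\<exists>P L. path_decomposition G P \<and> layering G L \<and> layered_width_le P L (lpw G)"
    unfolding lpw_def by (rule LeastI_ex)
  then show ?thesis using that by blast
qed

text \<open>If all branch sets of a model of the forest avoid and touch a connected set
  \<open>Q\<close>, then \<open>Q\<close> can be the branch set of the apex \<open>v\<close>: every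
  possible edge at \<open>v\<close> is available, whichever of them \<open>H\<close> has.\<close>

lemma lpw_le_if_no_minor:
  assumes G: "simple_graph G" and H: "simple_graph H" "apex_forest H" and "\<not> minor H G"
  shows "lpw G \<le> 3 * card (verts H) + 1"
proof -
  obtain v where v: "v \<in> verts H" "forest (delete_vertex H v)"
    using H(2) unfolding apex_forest_def by blast
  let ?F = "delete_vertex H v"
  let ?W = "verts ?F"
  have W: "?W = verts H - {v}" unfolding delete_vertex_def verts_def by simp
  have joined_F: "joined ?F a b" if "joined H a b" "a \<noteq> v" "b \<noteq> v" for a b
    using that unfolding delete_vertex_def edges_def by simp
  have "simple_graph ?F" unfolding simple_graph_def
  proof (intro conjI ballI)
    show "finite ?W" using H(1) W unfolding simple_graph_def by simp
    fix e assume "e \<in> edges ?F"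
    then have e: "e \<in> edges H" "v \<notin> e" unfolding delete_vertex_def edges_def by auto
    then obtain a b where "e = {a, b}" "a \<noteq> b" "a \<in> verts H" "b \<in> verts H"
      using H(1) unfolding simple_graph_def by blast
    then show "\<exists>a b. e = {a, b} \<and> a \<noteq> b \<and> a \<in> ?W \<and> b \<in> ?W" using e(2) W by auto
  qed
  then have deg: "degenerate (joined ?F) ?W" using v(2) by (intro forest_degenerate) simp_all
  have finG: "finite (verts G)" using G unfolding simple_graph_def by simp
  have "\<exists>P L. layered_pathdec (joined G) (verts G) (3 * card ?W + 1) P L"
  proof (rule layered_pathdec_exists[OF symp_joined symp_joined deg finG])
    fix Q \<mu>
    assume Q: "conn (joined G) Q" "Q \<subseteq> verts G" and \<mu>: "model (joined G) (joined ?F) ?W \<mu>"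
      and touch: "\<And>u. u \<in> ?W \<Longrightarrow> \<mu> u \<subseteq> verts G - Q \<and> (\<exists>x\<in>\<mu> u. \<exists>q\<in>Q. joined G x q)"
    define br where "br u = (if u = v then Q else \<mu> u)" for u
    have "minor H G" unfolding minor_def
    proof (intro exI[of _ br] conjI ballI allI impI)
      fix u assume u: "u \<in> verts H"
      show "connected_in G (br u)"
      proof (cases "u = v")
        case True
        then show ?thesis using conn_connected_in[OF Q] unfolding br_def by simp
      next
        case False
        then have "u \<in> ?W" using u W by simp
        then show ?thesis
          using conn_connected_in[OF modelD(1)[OF \<mu>]] touch False unfolding br_def by auto
      qed
    next
      fix u w assume uw: "u \<in> verts H" "w \<in> verts H" "u \<noteq> w"
      consider "u = v" "w \<in> ?W" | "w = v" "u \<in> ?W" | "u \<in> ?W" "w \<in> ?W" using uw W by blast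
      then show "br u \<inter> br w = {}"
      proof cases
        case 1
        then show ?thesis using touch[of w] uw(3) unfolding br_def by auto
      next
        case 2
        then show ?thesis using touch[of u] uw(3) unfolding br_def by auto
      next
        case 3
        then show ?thesis using modelD(2)[OF \<mu> 3 uw(3)] W unfolding br_def by simp
      qed
    next
      fix u w assume e: "{u, w} \<in> edges H"
      note uw = joined_verts[OF H(1) e]
      consider "u = v" "w \<in> ?W" | "w = v" "u \<in> ?W" | "u \<in> ?W" "w \<in> ?W" using uw W by blast
      then show "\<exists>x\<in>br u. \<exists>y\<in>br w. {x, y} \<in> edges G"
      proof cases
        case 1
        then obtain x q where "x \<in> \<mu> w" "q \<in> Q" "joined G x q" using touch by blast
        then show ?thesis using 1 uw(1) unfolding br_def by (metis insert_commute)
      next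
        case 2
        then show ?thesis using touch[of u] uw(1) unfolding br_def by simp
      next
        case 3
        then have "u \<noteq> v" "w \<noteq> v" using W by auto
        then show ?thesis using modelD(3)[OF \<mu> 3 uw(1) joined_F[OF e]] unfolding br_def by simp
      qed
    qed
    then show False using assms(4) by simp
  qed
  then obtain P L where dec: "layered_pathdec (joined G) (verts G) (3 * card ?W + 1) P L" by blast
  note P = layered_pathdecD(1)[OF dec]
  have "path_decomposition G P" unfolding path_decomposition_def
  proof (intro conjI ballI allI impI)
    fix B assume "B \<in> set P"
    then show "B \<subseteq> verts G" by (rule pathdecD(1)[OF P])
  next
    fix e assume "e \<in> edges G"
    moreover from this obtain x y where "e = {x, y}" "x \<in> verts G" "y \<in> verts G"
      using G unfolding simple_graph_def by meson
    ultimately have xy: "e = {x, y}" "x \<in> verts G" "y \<in> verts G" "joined G x y" by simp_all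
    then show "\<exists>B\<in>set P. e \<subseteq> B" using pathdecD(2)[OF P xy(2-4)] by auto
  next
    fix x assume "x \<in> verts G"
    then show "\<exists>i<length P. x \<in> P ! i" using pathdecD(3)[OF P, of x] by (auto simp: in_set_conv_nth)
  next
    fix x i j k assume "x \<in> verts G" "i \<le> j \<and> j \<le> k \<and> k < length P \<and> x \<in> P ! i \<and> x \<in> P ! k"
    then show "x \<in> P ! j" using contiguous_nth[OF pathdecD(4)[OF P], of x i j k] by simp
  qed
  moreover have "layering G L" unfolding layering_def
  proof (intro allI impI)
    fix x y assume e: "{x, y} \<in> edges G"
    then have e': "joined G y x" by (simp add: insert_commute)
    show "L x \<le> L y + 1 \<and> L y \<le> L x + 1"
      using layered_pathdecD(2)[OF dec _ _ e] layered_pathdecD(2)[OF dec _ _ e'] joined_verts[OF G e] by simp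
  qed
  moreover have "layered_width_le P L (3 * card ?W + 1)"
    using layered_pathdecD(3)[OF dec] unfolding layered_width_le_def by simp
  ultimately have "lpw G \<le> 3 * card ?W + 1" by (rule lpw_le)
  moreover have "card ?W \<le> card (verts H)" unfolding W by (rule card_Diff1_le)
  ultimately show ?thesis by linarith
qed

subsection \<open>Apex-forests of large layered pathwidth\<close>

text \<open>Complete ternary trees of height \<open>m\<close> in heap numbering, with root \<open>r\<close>.\<close>

fun ternary :: "nat \<Rightarrow> nat \<Rightarrow> nat set" where
  "ternary r 0 = {r}"
| "ternary r (Suc m) = insert r (\<Union>i\<in>{1, 2, 3}. ternary (3 * r + i) m)"

definition parent :: "nat \<Rightarrow> nat" where
  "parent x = (x - 1) div 3"

lemma parent_le: "parent x \<le> x"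
  unfolding parent_def by simp

lemma ternary_cases:
  assumes "x \<in> ternary r (Suc m)" "x \<noteq> r"
  obtains i where "i \<in> {1, 2, 3}" "x \<in> ternary (3 * r + i) m"
  using assms unfolding ternary.simps(2) by blast

lemma finite_ternary: "finite (ternary r m)"
  by (induction m arbitrary: r) auto

lemma root_in_ternary: "r \<in> ternary r m"
  by (cases m) auto

lemma ternary_ge: "x \<in> ternary r m \<Longrightarrow> r \<le> x"
proof (induction m arbitrary: r)
  case (Suc m)
  then show ?case by fastforce
qed simp

lemma parent_child: "i \<in> {1, 2, 3} \<Longrightarrow> parent (3 * r + i) = r"
  unfolding parent_def by auto

lemma parent_in_ternary: "x \<in> ternary r m \<Longrightarrow> x \<noteq> r \<Longrightarrow> parent x \<in> ternary r m"
proof (induction m arbitrary: r)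
  case (Suc m)
  then obtain i where i: "i \<in> {1, 2, 3}" "x \<in> ternary (3 * r + i) m" by (elim ternary_cases)
  show ?case
  proof (cases "x = 3 * r + i")
    case True
    then show ?thesis using parent_child[OF i(1)] root_in_ternary by simp
  next
    case False
    then have "parent x \<in> ternary (3 * r + i) m" using Suc.IH[OF i(2)] by simp
    then show ?thesis using i(1) unfolding ternary.simps(2) by blast
  qed
qed simp

lemma funpow_parent_le: "(parent ^^ n) x \<le> x"
proof (induction n)
  case (Suc n)
  have "parent ((parent ^^ n) x) \<le> (parent ^^ n) x" by (rule parent_le)
  then show ?case using Suc by simp
qed simp

lemma ternary_ancestor: "x \<in> ternary r m \<Longrightarrow> \<exists>n. (parent ^^ n) x = r"
proof (induction m arbitrary: r)
  case 0
  then show ?case by (intro exI[of _ 0]) simp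
next
  case (Suc m)
  show ?case
  proof (cases "x = r")
    case True
    then show ?thesis by (intro exI[of _ 0]) simp
  next
    case False
    then obtain i where i: "i \<in> {1, 2, 3}" "x \<in> ternary (3 * r + i) m"
      using Suc.prems by (elim ternary_cases)
    obtain n where "(parent ^^ n) x = 3 * r + i" using Suc.IH[OF i(2)] by blast
    then have "(parent ^^ Suc n) x = r" using parent_child[OF i(1)] by simp
    then show ?thesis by blast
  qed
qed

text \<open>A common vertex would have both siblings among its ancestors, so one sibling would be a
  proper ancestor of the other. But proper ancestors of a child of \<open>r\<close> are at most
  \<open>r\<close>, and the siblings are larger.\<close>

lemma ternary_disjoint:
  assumes "i \<in> {1, 2, 3}" "j \<in> {1, 2, 3}" "i \<noteq> j"
  shows "ternary (3 * r + i) m \<inter> ternary (3 * r + j) m = {}"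
proof -
  have False if x: "x \<in> ternary (3 * r + i) m" "x \<in> ternary (3 * r + j) m"
    and ij: "i \<in> {1, 2, 3}" "j \<in> {1, 2, 3}" "i \<noteq> j"
    and ab: "(parent ^^ a) x = 3 * r + i" "(parent ^^ b) x = 3 * r + j" "a \<le> b" for x i j a b
  proof -
    have "b = (b - a) + a" using ab(3) by simp
    then have e: "(parent ^^ (b - a)) (3 * r + i) = 3 * r + j"
      using ab(1,2) by (metis comp_apply funpow_add)
    show False
    proof (cases "b - a")
      case 0
      then show False using e ij(3) by simp
    next
      case (Suc n)
      then have "(parent ^^ n) (parent (3 * r + i)) = 3 * r + j" using e by (simp add: funpow_swap1)
      then have "(parent ^^ n) r = 3 * r + j" using parent_child[OF ij(1)] by simp
      then show False using funpow_parent_le[of n r] ij(2) by auto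
    qed
  qed
  then show ?thesis
    using ternary_ancestor assms by (metis (no_types, lifting) disjoint_iff nat_le_linear)
qed

lemma conn_ternary:
  assumes "symp adj" "\<And>x. x \<in> ternary r m \<Longrightarrow> x \<noteq> r \<Longrightarrow> adj x (parent x)"
  shows "conn adj (ternary r m)"
  using assms(2)
proof (induction m arbitrary: r)
  case 0
  then show ?case by (simp add: conn_singleton)
next
  case (Suc m)
  have c: "conn adj (insert r (ternary (3 * r + i) m))" if i: "i \<in> {1, 2, 3}" for i
  proof -
    have sub: "x \<in> ternary r (Suc m) \<and> x \<noteq> r" if "x \<in> ternary (3 * r + i) m" for x
      using that i ternary_ge[OF that] by auto
    have "conn adj (ternary (3 * r + i) m)"
      using Suc.prems sub by (intro Suc.IH) blast
    moreover have "adj (3 * r + i) r"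
      using Suc.prems sub[OF root_in_ternary] parent_child[OF i] by metis
    ultimately have "conn adj (ternary (3 * r + i) m \<union> {r})"
      using conn_Un_edge[OF assms(1) _ conn_singleton root_in_ternary] by blast
    then show ?thesis by simp
  qed
  let ?\<A> = "(\<lambda>i. insert r (ternary (3 * r + i) m)) ` {1, 2, 3}"
  have "conn adj (\<Union>?\<A>)"
  proof (rule conn_Union)
    fix A assume "A \<in> ?\<A>"
    then obtain i where "i \<in> {1, 2, 3}" "A = insert r (ternary (3 * r + i) m)" by (rule imageE)
    then show "conn adj A" "r \<in> A" using c by simp_all
  qed simp
  moreover have "\<Union>?\<A> = ternary r (Suc m)" by simp
  ultimately show ?case by simp
qed

text \<open>Split \<open>Z\<close> into the vertices that occur up to bag \<open>j\<close> and the
  others. An edge of \<open>Z\<close> between the two sides lies in a bag after \<open>j\<close>, so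
  its end in the first side must also be in bag \<open>j\<close>.\<close>

lemma path_decomposition_meets:
  assumes "path_decomposition G P" "conn (joined G) Z" "Z \<subseteq> verts G"
    and "i \<le> j" "j \<le> k" "k < length P" "Z \<inter> P ! i \<noteq> {}" "Z \<inter> P ! k \<noteq> {}"
  shows "Z \<inter> P ! j \<noteq> {}"
proof
  assume empty: "Z \<inter> P ! j = {}"
  have between: "v \<in> P ! b" if "v \<in> Z" "a \<le> b" "b \<le> c" "c < length P" "v \<in> P ! a" "v \<in> P ! c" for v a b c
    using path_decompositionD(4)[OF assms(1) _ that(2-6)] that(1) assms(3) by blast
  let ?S = "{z \<in> Z. \<exists>a\<le>j. z \<in> P ! a}"
  have "?S \<noteq> {}" using assms(4,7) by blast
  moreover have "?S \<noteq> Z"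
  proof
    assume "?S = Z"
    then obtain z a where "z \<in> Z" "z \<in> P ! k" "a \<le> j" "z \<in> P ! a" using assms(8) by blast
    then show False using between[of z a j k] assms(5,6) empty by blast
  qed
  ultimately obtain x y where xy: "x \<in> ?S" "y \<in> Z" "y \<notin> ?S" "joined G x y"
    using connD[OF assms(2), of ?S] by blast
  obtain B where "B \<in> set P" "{x, y} \<subseteq> B" using path_decompositionD(2)[OF assms(1) xy(4)] by blast
  then obtain b where b: "b < length P" "x \<in> P ! b" "y \<in> P ! b" by (metis in_set_conv_nth insert_subset)
  obtain a where a: "a \<le> j" "x \<in> P ! a" "x \<in> Z" using xy(1) by blast
  have "j < b" using xy(2,3) b(3) by (metis (mono_tags, lifting) leI mem_Collect_eq)
  then have "x \<in> P ! j" using between[of x a j b] a b by simp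
  then show False using empty a(3) by blast
qed

text \<open>Of three bags that are rich in the three subtrees, the middle one also meets the connected
  set formed by the root and the two other subtrees.\<close>

lemma ternary_large_bag:
  assumes "path_decomposition G P" "ternary r m \<subseteq> verts G"
    and "\<And>x. x \<in> ternary r m \<Longrightarrow> x \<noteq> r \<Longrightarrow> joined G x (parent x)"
  shows "\<exists>j<length P. m < card (P ! j \<inter> ternary r m)"
  using assms(2,3)
proof (induction m arbitrary: r)
  case 0
  then obtain j where "j < length P" "r \<in> P ! j" using path_decompositionD(3)[OF assms(1), of r] by auto
  then show ?case by (intro exI[of _ j]) simp
next
  case (Suc m)
  let ?t = "\<lambda>i. ternary (3 * r + i) m"
  have sub: "?t i \<subseteq> ternary r (Suc m)" "r \<notin> ?t i" if "i \<in> {1, 2, 3}" for i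
    using that ternary_ge[of r "3 * r + i" m] by auto
  have edge: "joined G x (parent x)" if "i \<in> {1, 2, 3}" "x \<in> ?t i" for i x
    using Suc.prems(2)[of x] sub[OF that(1)] that(2) by blast
  have "\<exists>j<length P. m < card (P ! j \<inter> ?t i)" if i: "i \<in> {1, 2, 3}" for i
    using Suc.prems(1) sub[OF i] edge[OF i] by (intro Suc.IH) blast+
  then obtain b where b: "\<And>i. i \<in> {1, 2, 3} \<Longrightarrow> b i < length P"
      "\<And>i. i \<in> {1, 2, 3} \<Longrightarrow> m < card (P ! b i \<inter> ?t i)"
    by metis
  have sorted: "\<exists>j<length P. Suc m < card (P ! j \<inter> ternary r (Suc m))"
    if i: "i \<in> {1, 2, 3}" "k \<in> {1, 2, 3}" "l \<in> {1, 2, 3}" "i \<noteq> k" "k \<noteq> l" "b i \<le> b k" "b k \<le> b l" for i k l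
  proof -
    let ?Z = "insert r (?t i) \<union> insert r (?t l)"
    have star: "conn (joined G) (insert r (?t a))" if a: "a \<in> {1, 2, 3}" for a
    proof -
      have "conn (joined G) (?t a)" using edge[OF a] by (intro conn_ternary symp_joined)
      moreover have "joined G (3 * r + a) r" using edge[OF a root_in_ternary] parent_child[OF a] by simp
      ultimately have "conn (joined G) (?t a \<union> {r})"
        using conn_Un_edge[OF symp_joined _ conn_singleton root_in_ternary] by blast
      then show ?thesis by simp
    qed
    have "conn (joined G) ?Z" using star[OF i(1)] star[OF i(3)] by (intro conn_Un[of _ _ _ r]) auto
    moreover have "?Z \<subseteq> verts G" using Suc.prems(1) sub(1)[OF i(1)] sub(1)[OF i(3)] by auto
    moreover have "?t a \<inter> P ! b a \<noteq> {}" if "a \<in> {1, 2, 3}" for a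
      using b(2)[OF that] by (metis Int_commute card.empty not_less_zero)
    then have "?Z \<inter> P ! b i \<noteq> {}" "?Z \<inter> P ! b l \<noteq> {}" using i(1,3) by blast+
    ultimately have "?Z \<inter> P ! b k \<noteq> {}"
      using path_decomposition_meets[OF assms(1), of ?Z "b i" "b k" "b l"] i(6,7) b(1)[OF i(3)] by simp
    then obtain z where z: "z \<in> ?Z" "z \<in> P ! b k" by blast
    \<comment> \<open>This extra vertex, outside the middle subtree, is the gain of one per
      level.\<close>
    have "z \<notin> ?t k"
      using z(1) sub(2)[OF i(2)] ternary_disjoint[OF i(1,2,4), of r m] ternary_disjoint[OF i(2,3,5), of r m] by blast
    then have "card (insert z (P ! b k \<inter> ?t k)) = Suc (card (P ! b k \<inter> ?t k))"
      using finite_ternary by simp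
    moreover have "insert z (P ! b k \<inter> ?t k) \<subseteq> P ! b k \<inter> ternary r (Suc m)"
      using z sub(1)[OF i(1)] sub(1)[OF i(2)] sub(1)[OF i(3)] by auto
    then have "card (insert z (P ! b k \<inter> ?t k)) \<le> card (P ! b k \<inter> ternary r (Suc m))"
      using finite_ternary by (intro card_mono finite_Int disjI2)
    ultimately have "Suc m < card (P ! b k \<inter> ternary r (Suc m))" using b(2)[OF i(2)] by linarith
    then show ?thesis using b(1)[OF i(2)] by blast
  qed
  consider "b 1 \<le> b 2" "b 2 \<le> b 3" | "b 1 \<le> b 3" "b 3 \<le> b 2" | "b 2 \<le> b 1" "b 1 \<le> b 3"
    | "b 2 \<le> b 3" "b 3 \<le> b 1" | "b 3 \<le> b 1" "b 1 \<le> b 2" | "b 3 \<le> b 2" "b 2 \<le> b 1"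
    by linarith
  then show ?case
  proof cases
    case 1 then show ?thesis using sorted[of 1 2 3] by simp
  next
    case 2 then show ?thesis using sorted[of 1 3 2] by simp
  next
    case 3 then show ?thesis using sorted[of 2 1 3] by simp
  next
    case 4 then show ?thesis using sorted[of 2 3 1] by simp
  next
    case 5 then show ?thesis using sorted[of 3 1 2] by simp
  next
    case 6 then show ?thesis using sorted[of 3 2 1] by simp
  qed
qed

text \<open>The root is 1 because then its \<open>parent\<close> is 0, the apex: the formula for the
  tree edges yields at the root just the edge to the apex, which is present anyway.\<close>

definition apex_ternary :: "nat \<Rightarrow> graph" where
  "apex_ternary m = (insert 0 (ternary 1 m),
    (\<lambda>x. {x, parent x}) ` ternary 1 m \<union> (\<lambda>x. {0, x}) ` ternary 1 m)"

lemma verts_apex_ternary: "verts (apex_ternary m) = insert 0 (ternary 1 m)"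
  unfolding apex_ternary_def verts_def by simp

lemma edges_apex_ternary:
  "edges (apex_ternary m) = (\<lambda>x. {x, parent x}) ` ternary 1 m \<union> (\<lambda>x. {0, x}) ` ternary 1 m"
  unfolding apex_ternary_def edges_def by simp

lemma simple_apex_ternary: "simple_graph (apex_ternary m)"
  unfolding simple_graph_def verts_apex_ternary edges_apex_ternary
proof (intro conjI ballI)
  fix e assume "e \<in> (\<lambda>x. {x, parent x}) ` ternary 1 m \<union> (\<lambda>x. {0, x}) ` ternary 1 m"
  then obtain x where x: "x \<in> ternary 1 m" "e = {x, parent x} \<or> e = {x, 0}" by blast
  have "1 \<le> x" using ternary_ge[OF x(1)] .
  then have "parent x \<noteq> x" "x \<noteq> 0" unfolding parent_def by auto
  moreover have "parent x \<in> insert 0 (ternary 1 m)"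
    using parent_in_ternary[OF x(1)] by (cases "x = 1") (auto simp: parent_def)
  ultimately show "\<exists>u v. e = {u, v} \<and> u \<noteq> v \<and> u \<in> insert 0 (ternary 1 m) \<and> v \<in> insert 0 (ternary 1 m)"
    using x by (metis insertI1 insertI2)
qed (simp add: finite_ternary)

text \<open>Both neighbours on a cycle of its largest vertex would be smaller than it, hence both
  equal to its parent, although a cycle of length at least 3 has two different ones.\<close>

lemma apex_forest_apex_ternary: "apex_forest (apex_ternary m)"
  unfolding apex_forest_def
proof (intro bexI[of _ 0])
  let ?F = "delete_vertex (apex_ternary m) 0"
  have lower: "y = parent x" if "{x, y} \<in> edges ?F" "y \<le> x" for x y
  proof -
    have "{x, y} \<in> edges (apex_ternary m)" "0 \<notin> {x, y}"
      using that(1) unfolding delete_vertex_def edges_def by auto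
    then obtain z where "{x, y} = {z, parent z}" unfolding edges_apex_ternary by blast
    then consider "x = z" "y = parent z" | "x = parent z" "y = z" by (auto simp: doubleton_eq_iff)
    then show ?thesis
    proof cases
      case 2
      then have "parent z = z" using that(2) parent_le[of z] by simp
      then show ?thesis using 2 by simp
    qed simp
  qed
  show "forest ?F" unfolding forest_def
  proof
    assume "\<exists>xs. is_cycle ?F xs"
    then obtain xs where xs: "3 \<le> length xs" "distinct xs" "{last xs, hd xs} \<in> edges ?F"
      "\<And>i. Suc i < length xs \<Longrightarrow> {xs ! i, xs ! Suc i} \<in> edges ?F"
      unfolding is_cycle_def by blast
    let ?n = "length xs"
    have "set xs \<noteq> {}" using xs(1) by auto
    then have "Max (set xs) \<in> set xs" by (intro Max_in) auto
    then obtain i where i: "i < ?n" "xs ! i = Max (set xs)" by (metis in_set_conv_nth)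
    have le: "xs ! j \<le> xs ! i" if "j < ?n" for j using that i(2) by simp
    have wrap: "{xs ! (?n - 1), xs ! 0} \<in> edges ?F"
      using xs(1,3) by (metis \<open>set xs \<noteq> {}\<close> hd_conv_nth last_conv_nth set_empty)
    define next_i where "next_i = (if Suc i < ?n then Suc i else 0)"
    define prev_i where "prev_i = (if i = 0 then ?n - 1 else i - 1)"
    have "{xs ! i, xs ! next_i} \<in> edges ?F"
    proof (cases "Suc i < ?n")
      case True
      then show ?thesis using xs(4) unfolding next_i_def by simp
    next
      case False
      then have "i = ?n - 1" using i(1) by simp
      then show ?thesis using wrap False unfolding next_i_def by simp
    qed
    moreover have "{xs ! i, xs ! prev_i} \<in> edges ?F"
    proof (cases i)
      case 0
      then show ?thesis using wrap unfolding prev_i_def by (simp add: insert_commute)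
    next
      case (Suc j)
      then show ?thesis using xs(4)[of j] i(1) unfolding prev_i_def by (simp add: insert_commute)
    qed
    moreover have "next_i < ?n" "prev_i < ?n" "next_i \<noteq> prev_i"
      using i(1) xs(1) unfolding next_i_def prev_i_def by auto
    ultimately show False
      using lower le xs(2) nth_eq_iff_index_eq by metis
  qed
qed (simp add: verts_apex_ternary)

text \<open>All tree vertices are adjacent to 0 and thus lie in at most three layers, while some bag
  has more than \<open>m\<close> tree vertices.\<close>

lemma lpw_apex_ternary: "m < 3 * lpw (apex_ternary m)"
proof -
  let ?G = "apex_ternary m"
  let ?c = "lpw ?G"
  obtain P L where P: "path_decomposition ?G P" and L: "layering ?G L" and w: "layered_width_le P L ?c"
    using lpw_attained[OF simple_apex_ternary] .
  obtain j where j: "j < length P" "m < card (P ! j \<inter> ternary 1 m)"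
    using ternary_large_bag[OF P, of 1 m] by (auto simp: verts_apex_ternary edges_apex_ternary)
  \<comment> \<open>For \<open>L 0 = 0\<close>, truncated subtraction merges two of these layers;
    only the bound 3 on their number matters.\<close>
  let ?I = "{L 0 - 1, L 0, L 0 + 1}"
  have "L x \<in> ?I" if "x \<in> ternary 1 m" for x
  proof -
    have "{0, x} \<in> edges ?G" using that unfolding edges_apex_ternary by blast
    then have "L 0 \<le> L x + 1 \<and> L x \<le> L 0 + 1" using L unfolding layering_def by blast
    then show ?thesis by auto
  qed
  then have "P ! j \<inter> ternary 1 m \<subseteq> (\<Union>i\<in>?I. {v \<in> P ! j. L v = i})" by auto
  moreover have "finite (P ! j)"
  proof -
    have "P ! j \<subseteq> verts ?G" using path_decompositionD(1)[OF P nth_mem[OF j(1)]] .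
    then show ?thesis using finite_ternary unfolding verts_apex_ternary by (meson finite_insert finite_subset)
  qed
  ultimately have "card (P ! j \<inter> ternary 1 m) \<le> card (\<Union>i\<in>?I. {v \<in> P ! j. L v = i})"
    by (intro card_mono) auto
  also have "\<dots> \<le> (\<Sum>i\<in>?I. card {v \<in> P ! j. L v = i})" by (rule card_UN_le) simp
  also have "\<dots> \<le> card ?I * ?c"
    using sum_bounded_above[of ?I "\<lambda>i. card {v \<in> P ! j. L v = i}" ?c] w nth_mem[OF j(1)]
    unfolding layered_width_le_def by simp
  also have "\<dots> \<le> 3 * ?c" by (intro mult_le_mono1) (auto simp: card_insert_if)
  finally show ?thesis using j(2) by linarith
qed

theorem theorem4:
  fixes \<G> :: "graph set"
  assumes "\<forall>G\<in>\<G>. simple_graph G"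
    and "minor_closed \<G>"
  shows "(\<exists>c::nat. \<forall>G\<in>\<G>. lpw G \<le> c) \<longleftrightarrow>
         (\<exists>G. simple_graph G \<and> apex_forest G \<and> G \<notin> \<G>)"
proof
  assume "\<exists>c::nat. \<forall>G\<in>\<G>. lpw G \<le> c"
  then obtain c where c: "\<And>G. G \<in> \<G> \<Longrightarrow> lpw G \<le> c" by blast
  \<comment> \<open>Height \<open>3 * c\<close> turns \<open>m < 3 * lpw\<close> into
    \<open>c < lpw\<close>.\<close>
  have "apex_ternary (3 * c) \<notin> \<G>"
    using c[of "apex_ternary (3 * c)"] lpw_apex_ternary[of "3 * c"] by linarith
  then show "\<exists>G. simple_graph G \<and> apex_forest G \<and> G \<notin> \<G>"
    using simple_apex_ternary apex_forest_apex_ternary by blast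
next
  assume "\<exists>G. simple_graph G \<and> apex_forest G \<and> G \<notin> \<G>"
  then obtain H where H: "simple_graph H" "apex_forest H" "H \<notin> \<G>" by blast
  have "lpw G \<le> 3 * card (verts H) + 1" if "G \<in> \<G>" for G
  proof (rule lpw_le_if_no_minor[OF _ H(1,2)])
    show "simple_graph G" using assms(1) that by blast
    show "\<not> minor H G" using assms(2) that H(1,3) unfolding minor_closed_def by blast
  qed
  then show "\<exists>c::nat. \<forall>G\<in>\<G>. lpw G \<le> c" by blast
qed

end
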